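(* Let $n\ge2$. On Euclidean upper half space $(\mathbb R_+^{n+1},dx^2)$, $\mathbb R_+^{n+1}=\{(x,y):x\in\mathbb R^n,\ y\ge0\}$, $$\int_{\mathbb R_+^{n+1}}|\nabla^2u|^2\geq2\int_{\mathbb R^n}\left[f(-\Delta)^{3/2}f-\langle\overline\nabla f,\overline\nabla\psi\rangle+\psi(-\Delta)^{1/2}\psi\right]$$ for all $u\in C_0^\infty(\mathbb R_+^{n+1})$, where $f(x)=u(x,0)$ and $\psi(x)=-u_y(x,0)$. Moreover, equality holds if and only if $\Delta^2u=0$.
   Context: $C_0^\infty(\mathbb R_+^{n+1})$ denotes smooth functions with compact support in the closed half space (not required to vanish on $\{y=0\}$). On $\mathbb R^n$, $(-\Delta)^{\gamma}$ is the fractional Laplacian with Fourier symbol $|\xi|^{2\gamma}$ and $\overline\nabla$ is the gradient; $\nabla^2u$ is the Hessian of $u$ in $\mathbb R^{n+1}_+$ and $\Delta^2u$ the bi-Laplacian in $\mathbb R^{n+1}_+$. *)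

theory Defs
  imports "HOL-Analysis.Analysis"
begin

text \<open>Points of the closed upper half space are pairs \<open>(x, y)\<close> with \<open>x\<close> in \<open>real^'n\<close> and
  \<open>y \<ge> 0\<close>; the product norm on \<open>real^'n \<times> real\<close> is the Euclidean one.\<close>

definition half_space :: "((real^'n) \<times> real) set" where
  "half_space = {p. 0 \<le> snd p}"

text \<open>Derivatives are taken within the set \<open>S\<close>, so for \<open>S = half_space\<close> they are one-sided in the
  normal direction on the boundary and do not depend on values outside \<open>S\<close>. They are uniquely
  determined since the half space is convex with nonempty interior.\<close>

definition dderiv ::
    "'a::euclidean_space set \<Rightarrow> 'a \<Rightarrow> ('a \<Rightarrow> real) \<Rightarrow> 'a \<Rightarrow> real" where
  "dderiv S b u p = frechet_derivative u (at p within S) b"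

text \<open>Smoothness up to the boundary: all iterated partial derivatives are (Frechet) differentiable
  within \<open>S\<close>, hence also continuous on \<open>S\<close>.\<close>

definition smooth_on :: "'a::euclidean_space set \<Rightarrow> ('a \<Rightarrow> real) \<Rightarrow> bool" where
  "smooth_on S u \<longleftrightarrow>
     (\<forall>bs. set bs \<subseteq> Basis \<longrightarrow> (foldr (dderiv S) bs u) differentiable_on S)"

text \<open>For the closed half space the support may meet the boundary.\<close>

definition test_functions :: "'a::euclidean_space set \<Rightarrow> ('a \<Rightarrow> real) set" where
  "test_functions S = {u. smooth_on S u \<and> compact (closure {p \<in> S. u p \<noteq> 0})}"

definition hessian_norm_sq :: "'a::euclidean_space set \<Rightarrow> ('a \<Rightarrow> real) \<Rightarrow> 'a \<Rightarrow> real" where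
  "hessian_norm_sq S u p = (\<Sum>b\<in>Basis. \<Sum>c\<in>Basis. (dderiv S b (dderiv S c u) p)\<^sup>2)"

definition laplacian :: "'a::euclidean_space set \<Rightarrow> ('a \<Rightarrow> real) \<Rightarrow> 'a \<Rightarrow> real" where
  "laplacian S u p = (\<Sum>b\<in>Basis. dderiv S b (dderiv S b u) p)"

definition bilaplacian :: "'a::euclidean_space set \<Rightarrow> ('a \<Rightarrow> real) \<Rightarrow> 'a \<Rightarrow> real" where
  "bilaplacian S u = laplacian S (laplacian S u)"

definition grad :: "('a::euclidean_space \<Rightarrow> real) \<Rightarrow> 'a \<Rightarrow> 'a" where
  "grad f x = (\<Sum>b\<in>Basis. dderiv UNIV b f x *\<^sub>R b)"

text \<open>With the kernel \<open>exp (- i x \<xi>)\<close> the symbol of minus the Laplacian is \<open>|\<xi>|\<^sup>2\<close>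
  without factors of \<open>2 \<pi>\<close>, which appear in the inversion formula instead.\<close>

definition fourier :: "('a::euclidean_space \<Rightarrow> complex) \<Rightarrow> 'a \<Rightarrow> complex" where
  "fourier f \<xi> = (LINT x|lborel. cis (- (x \<bullet> \<xi>)) * f x)"

definition inverse_fourier :: "('a::euclidean_space \<Rightarrow> complex) \<Rightarrow> 'a \<Rightarrow> complex" where
  "inverse_fourier g x =
     (LINT \<xi>|lborel. cis (x \<bullet> \<xi>) * g \<xi>) / of_real ((2 * pi) ^ DIM('a))"

definition frac_laplacian_complex ::
    "real \<Rightarrow> ('a::euclidean_space \<Rightarrow> complex) \<Rightarrow> 'a \<Rightarrow> complex" where
  "frac_laplacian_complex \<gamma> f =
     inverse_fourier (\<lambda>\<xi>. of_real (norm \<xi> powr (2 * \<gamma>)) * fourier f \<xi>)"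

definition frac_laplacian ::
    "real \<Rightarrow> ('a::euclidean_space \<Rightarrow> real) \<Rightarrow> 'a \<Rightarrow> real" where
  "frac_laplacian \<gamma> f x = Re (frac_laplacian_complex \<gamma> (\<lambda>z. of_real (f z)) x)"

text \<open>Taking the real part loses nothing: the value is real for real-valued \<open>f\<close>.\<close>

lemma lborel_integral_uminus:
  fixes g :: "'a::euclidean_space \<Rightarrow> complex"
  shows "(LINT \<xi>|lborel. g (- \<xi>)) = (LINT \<xi>|lborel. g \<xi>)"
proof -
  have D: "distr lborel borel uminus = (lborel :: 'a measure)"
    using lborel_affine [of "-1" "0 :: 'a"] by (simp add: density_1)
  have eq: "(LINT \<xi>|lborel. h (- \<xi>)) = (LINT \<xi>|lborel. h \<xi>)"
    if "h \<in> borel_measurable borel" for h :: "'a \<Rightarrow> complex"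
    using integral_distr [of "uminus" lborel "borel :: 'a measure" h] that by (simp add: D)
  show ?thesis
  proof (cases "g \<in> borel_measurable borel")
    case True
    then show ?thesis by (rule eq)
  next
    case False
    have "(\<lambda>\<xi>. g (- \<xi>)) \<notin> borel_measurable borel"
    proof
      assume "(\<lambda>\<xi>. g (- \<xi>)) \<in> borel_measurable borel"
      then have "(\<lambda>\<xi>. g (- (- \<xi>))) \<in> borel_measurable borel"
        by (rule measurable_compose [rotated]) simp
      then show False using False by simp
    qed
    then show ?thesis
      using False by (metis borel_measurable_integrable measurable_lborel2 not_integrable_integral_eq)
  qed
qed

lemma of_real_frac_laplacian:
  "of_real (frac_laplacian \<gamma> f x) = frac_laplacian_complex \<gamma> (\<lambda>z. of_real (f z)) x"
proof -
  let ?F = "fourier (\<lambda>z. of_real (f z))"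
  let ?G = "\<lambda>\<xi>. cis (x \<bullet> \<xi>) * (of_real (norm \<xi> powr (2 * \<gamma>)) * ?F \<xi>)"
  have F: "cnj (?F \<xi>) = ?F (- \<xi>)" for \<xi>
    unfolding fourier_def by (simp flip: Bochner_Integration.integral_cnj add: cis_cnj)
  have "cnj (LINT \<xi>|lborel. ?G \<xi>) = (LINT \<xi>|lborel. cnj (?G \<xi>))"
    by (rule Bochner_Integration.integral_cnj [symmetric])
  also have "\<dots> = (LINT \<xi>|lborel. ?G (- \<xi>))"
    by (simp add: F cis_cnj)
  also have "\<dots> = (LINT \<xi>|lborel. ?G \<xi>)"
    by (rule lborel_integral_uminus)
  finally have "cnj (frac_laplacian_complex \<gamma> (\<lambda>z. of_real (f z)) x) =
      frac_laplacian_complex \<gamma> (\<lambda>z. of_real (f z)) x"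
    by (simp add: frac_laplacian_complex_def inverse_fourier_def)
  then show ?thesis
    by (simp add: frac_laplacian_def complex_eq_iff)
qed

end

theory Submission
  imports Defs "HOL-Probability.Characteristic_Functions" "HOL-Probability.Sinc_Integral"
begin

text \<open>Take the Fourier transform \<open>v\<close> of \<open>u\<close> in \<open>x\<close> and put \<open>r = |\<xi>|\<close>. By Parseval the left hand side
  is the integral over \<open>\<xi>\<close> and \<open>y \<ge> 0\<close> of \<open>r\<^sup>4|v|\<^sup>2 + 2r\<^sup>2|v'|\<^sup>2 + |v''|\<^sup>2\<close>, which equals
  \<open>|v'' + 2rv' + r\<^sup>2v|\<^sup>2\<close> minus an exact \<open>y\<close>-derivative, and the boundary term left by that
  derivative is the Fourier side of the right hand side. Hence the inequality, with equality iff
  \<open>(d/dy + r)\<^sup>2 v = 0\<close> for almost every \<open>\<xi>\<close>. Since \<open>v\<close> has compact support in \<open>y\<close>, this forces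
  \<open>v = 0\<close>, that is \<open>u = 0\<close>; the biharmonic equation \<open>(d/dy - r)\<^sup>2(d/dy + r)\<^sup>2 v = 0\<close> forces the
  same, so both sides of the equivalence mean \<open>u = 0\<close>.\<close>

section \<open>Gaussians and Fourier inversion\<close>

text \<open>For \<open>r > 0\<close> and given \<open>v(0)\<close>, \<open>v'(0)\<close>, the
  solution \<open>(a + b y) exp (- r y)\<close> of \<open>(d/dy + r)\<^sup>2 v = 0\<close> minimises
  the energy, and the boundary term is the energy of this minimiser. With \<open>- r\<close> in the
  square the boundary term would be nonpositive and the bound empty. The minimiser decays without
  being compactly supported, which is why equality leaves only zero. The fractional Laplacians are
  pointwise inverse Fourier integrals. They reach the Fourier side only once
  \<open>|\<xi>|\<^sup>3\<close> times the transform of a test function is known to be integrable;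
  this is what the inversion theorem and the decay estimates serve. Symmetry of mixed derivatives up
  to the boundary is bypassed: after the transform a tangential derivative is a factor independent
  of \<open>y\<close>, so it commutes with \<open>d/dy\<close>. The variables \<open>\<xi>\<close>
  and \<open>y\<close> are interchanged only between nonnegative extended integrals, so no estimate
  of \<open>v\<close> uniform in \<open>y\<close> enters; finiteness of the deficit comes out of the
  identity itself.\<close>

lemma integrable_pair_mult:
  fixes f :: "'a::euclidean_space \<Rightarrow> complex" and g :: "'b::euclidean_space \<Rightarrow> complex"
  assumes f: "integrable lborel f" and g: "integrable lborel g"
  shows "integrable (lborel \<Otimes>\<^sub>M lborel) (\<lambda>(x, y). f x * g y)"
proof -
  note [measurable] = borel_measurable_integrable[OF f, simplified]
    borel_measurable_integrable[OF g, simplified]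
  show ?thesis
  proof (rule lborel_pair.Fubini_integrable)
    show "integrable lborel (\<lambda>x. LINT y|lborel. norm (case (x, y) of (x, y) \<Rightarrow> f x * g y))"
      using f by (simp add: norm_mult)
    show "AE x in lborel. integrable lborel (\<lambda>y. case (x, y) of (x, y) \<Rightarrow> f x * g y)"
      using g by simp
  qed measurable
qed

text \<open>A kernel of modulus at most 1 leaves \<open>f x * g y\<close> as a majorant. With
  exponentials for \<open>k\<close>, the Fourier kernel passes from one factor to the other, which
  drives both the inversion theorem and the Parseval identity.\<close>

lemma Fubini_kernel:
  fixes f :: "'a::euclidean_space \<Rightarrow> complex" and g :: "'b::euclidean_space \<Rightarrow> complex"
    and k :: "'a \<Rightarrow> 'b \<Rightarrow> complex"
  assumes f: "integrable lborel f" and g: "integrable lborel g"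
    and k: "(\<lambda>(x, y). k x y) \<in> borel_measurable borel" and k1: "\<And>x y. norm (k x y) \<le> 1"
  shows "(LINT x|lborel. f x * (LINT y|lborel. k x y * g y)) =
    (LINT y|lborel. g y * (LINT x|lborel. k x y * f x))"
proof -
  have [measurable]: "(\<lambda>p. k (fst p) (snd p)) \<in> borel_measurable (borel \<Otimes>\<^sub>M borel)"
    using k by (simp add: borel_prod split_beta')
  note [measurable] = borel_measurable_integrable[OF f, simplified]
    borel_measurable_integrable[OF g, simplified]
  have "integrable (lborel \<Otimes>\<^sub>M lborel) (\<lambda>(x, y). f x * g y * k x y)"
  proof (rule Bochner_Integration.integrable_bound[OF integrable_pair_mult[OF f g]])
    show "AE x in lborel \<Otimes>\<^sub>M lborel. norm (case x of (x, y) \<Rightarrow> f x * g y * k x y)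
        \<le> norm (case x of (x, y) \<Rightarrow> f x * g y)"
      using k1 by (auto simp: norm_mult intro!: AE_I2 mult_right_le_one_le)
  qed (simp add: split_beta')
  from lborel_pair.Fubini_integral[OF this]
  have "(LINT x|lborel. LINT y|lborel. f x * g y * k x y) =
      (LINT y|lborel. LINT x|lborel. f x * g y * k x y)"
    by simp
  then show ?thesis
    by (simp flip: integral_mult_right_zero add: mult_ac)
qed

lemma lborel_integral_affine:
  fixes f :: "'a::euclidean_space \<Rightarrow> complex" and c :: real
  assumes [measurable]: "f \<in> borel_measurable borel" and c: "0 < c"
  shows "(LINT x|lborel. f x) = of_real (c ^ DIM('a)) * (LINT x|lborel. f (t + c *\<^sub>R x))"
proof -
  have "(LINT x|lborel. f x) =
      (LINT x|density (distr lborel borel (\<lambda>x. t + c *\<^sub>R x)) (\<lambda>_. \<bar>c\<bar> ^ DIM('a)). f x)"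
    using c by (subst lborel_affine[of c t]) auto
  also have "\<dots> = of_real (c ^ DIM('a)) * (LINT x|lborel. f (t + c *\<^sub>R x))"
    using c by (simp add: integral_density integral_distr scaleR_conv_of_real)
  finally show ?thesis .
qed

lemma lborel_integrable_affine:
  fixes f :: "'a::euclidean_space \<Rightarrow> complex" and c :: real
  assumes "integrable lborel f" and c: "0 < c"
  shows "integrable lborel (\<lambda>x. f (t + c *\<^sub>R x))"
proof -
  have [measurable]: "f \<in> borel_measurable borel"
    using assms(1) by auto
  have "integrable (density (distr lborel borel (\<lambda>x. t + c *\<^sub>R x)) (\<lambda>_. \<bar>c\<bar> ^ DIM('a))) f"
    using assms by (subst (asm) lborel_affine[of c t]) auto
  then have "integrable lborel (\<lambda>x. c ^ DIM('a) *\<^sub>R f (t + c *\<^sub>R x))"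
    using c by (simp add: integrable_density integrable_distr_eq)
  then have "integrable lborel (\<lambda>x. (1 / c ^ DIM('a)) *\<^sub>R (c ^ DIM('a) *\<^sub>R f (t + c *\<^sub>R x)))"
    by (rule integrable_scaleR_right)
  then show ?thesis
    using c by simp
qed

text \<open>Lebesgue measure is the image of the product measure indexed by \<open>Basis\<close>, so
  tensor products factor. This reduces the Gaussian and the weight used for decay to one
  dimension.\<close>

lemma lborel_prod_Basis:
  fixes h :: "'a::euclidean_space \<Rightarrow> real \<Rightarrow> complex"
  assumes h: "\<And>b. b \<in> Basis \<Longrightarrow> integrable lborel (h b)"
  shows "integrable lborel (\<lambda>x::'a. \<Prod>b\<in>Basis. h b (x \<bullet> b))"
    and "(LINT x|(lborel :: 'a measure). (\<Prod>b\<in>Basis. h b (x \<bullet> b))) = (\<Prod>b\<in>Basis. LINT t|lborel. h b t)"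
proof -
  interpret product_sigma_finite "\<lambda>_::'a. lborel :: real measure" ..
  note [measurable] = borel_measurable_integrable[OF h, simplified]
  have eq: "(\<Prod>b\<in>Basis. h b ((\<Sum>c\<in>Basis. f c *\<^sub>R c) \<bullet> b)) = (\<Prod>b\<in>Basis. h b (f b))" for f :: "'a \<Rightarrow> real"
    by (intro prod.cong refl) (simp add: inner_sum_left inner_Basis if_distrib sum.delta' cong: if_cong)
  show "integrable lborel (\<lambda>x::'a. \<Prod>b\<in>Basis. h b (x \<bullet> b))"
    using h
    by (subst lborel_eq, subst integrable_distr_eq) (auto simp: eq intro!: product_integrable_prod)
  show "(LINT x|(lborel :: 'a measure). (\<Prod>b\<in>Basis. h b (x \<bullet> b))) = (\<Prod>b\<in>Basis. LINT t|lborel. h b t)"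
    using h by (subst lborel_eq, subst integral_distr) (auto simp: eq intro!: product_integral_prod)
qed

section \<open>The Gaussian and its Fourier transform\<close>

definition gaussian :: "'a::euclidean_space \<Rightarrow> complex" where
  "gaussian x = of_real (exp (- (x \<bullet> x) / 2))"

lemma gaussian_norm_le: "norm (gaussian x) \<le> 1"
  by (simp add: gaussian_def)

lemma gaussian_measurable [measurable]: "gaussian \<in> borel_measurable borel"
  unfolding gaussian_def by measurable

text \<open>This is the characteristic function of the standard normal distribution, with the
  normalising constant of the density moved to the other side.\<close>

lemma gaussian_1D:
  fixes t :: real
  shows "integrable lborel (\<lambda>x. cis (t * x) * gaussian x)"
    and "(LINT x|lborel. cis (t * x) * gaussian x) = of_real (sqrt (2 * pi)) * gaussian t"
proof -
  have eq: "cis (t * x) * gaussian x =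
      of_real (sqrt (2 * pi)) * (std_normal_density x *\<^sub>R cis (t * x))" for x
    by (simp add: normal_density_def gaussian_def power2_eq_square scaleR_conv_of_real)
  have "(LINT x|lborel. std_normal_density x *\<^sub>R cis (t * x)) = gaussian t"
    using char_std_normal_distribution
    by (simp add: char_def fun_eq_iff integral_density cis_conv_exp gaussian_def power2_eq_square)
  then show "(LINT x|lborel. cis (t * x) * gaussian x) = of_real (sqrt (2 * pi)) * gaussian t"
    unfolding eq integral_mult_right_zero by simp
  have "integrable lborel (\<lambda>x. std_normal_density x *\<^sub>R cis (t * x))"
  proof (rule Bochner_Integration.integrable_bound)
    show "integrable lborel std_normal_density"
      by (rule integrable_normal_density) simp
  qed (auto simp: cis_conv_exp)
  then show "integrable lborel (\<lambda>x. cis (t * x) * gaussian x)"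
    unfolding eq by (rule integrable_mult_right)
qed

lemma cis_sum: "finite A \<Longrightarrow> cis (\<Sum>a\<in>A. f a) = (\<Prod>a\<in>A. cis (f a))"
  by (induction A rule: finite_induct) (auto simp flip: cis_mult)

lemma cis_gaussian_prod:
  fixes x \<xi> :: "'a::euclidean_space"
  shows "cis (x \<bullet> \<xi>) * gaussian x = (\<Prod>b\<in>Basis. cis ((\<xi> \<bullet> b) * (x \<bullet> b)) * gaussian (x \<bullet> b))"
    and "gaussian \<xi> = (\<Prod>b\<in>Basis. gaussian (\<xi> \<bullet> b))"
proof -
  have g: "gaussian y = (\<Prod>b\<in>Basis. gaussian (y \<bullet> b))" for y :: 'a
    unfolding gaussian_def
    by (subst euclidean_inner)
      (simp add: sum_negf sum_divide_distrib flip: exp_sum of_real_prod)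
  show "gaussian \<xi> = (\<Prod>b\<in>Basis. gaussian (\<xi> \<bullet> b))"
    by (rule g)
  have "cis (x \<bullet> \<xi>) = (\<Prod>b\<in>Basis. cis ((\<xi> \<bullet> b) * (x \<bullet> b)))"
    by (subst euclidean_inner) (simp add: cis_sum mult.commute)
  then show "cis (x \<bullet> \<xi>) * gaussian x = (\<Prod>b\<in>Basis. cis ((\<xi> \<bullet> b) * (x \<bullet> b)) * gaussian (x \<bullet> b))"
    using g[of x] by (simp add: prod.distrib)
qed

lemma gaussian_integral:
  fixes \<xi> :: "'a::euclidean_space"
  shows "integrable lborel (\<lambda>x. cis (x \<bullet> \<xi>) * gaussian x)"
    and "(LINT x|lborel. cis (x \<bullet> \<xi>) * gaussian x) = of_real (sqrt (2 * pi) ^ DIM('a)) * gaussian \<xi>"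
proof -
  note P = lborel_prod_Basis[of "\<lambda>b t. cis ((\<xi> \<bullet> b) * t) * gaussian t", OF gaussian_1D(1)]
  show "integrable lborel (\<lambda>x. cis (x \<bullet> \<xi>) * gaussian x)"
    using P(1) by (simp add: cis_gaussian_prod(1))
  show "(LINT x|lborel. cis (x \<bullet> \<xi>) * gaussian x) = of_real (sqrt (2 * pi) ^ DIM('a)) * gaussian \<xi>"
    using P(2) by (simp add: cis_gaussian_prod(1) gaussian_1D(2) prod.distrib
        cis_gaussian_prod(2)[of \<xi>])
qed

lemma cis_measurable [measurable]: "cis \<in> borel_measurable borel"
  by (intro borel_measurable_continuous_onI continuous_intros)

text \<open>Exchanging the integrals directly would leave a divergent integral of exponentials over
  \<open>\<xi>\<close>, so the factor \<open>gaussian (e k *\<^sub>R \<xi>)\<close> is inserted.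
  After Fubini it acts as an approximate identity at \<open>x\<close>. As \<open>e k\<close> tends
  to 0 both forms converge: one is dominated by \<open>fourier g\<close>, the other uses continuity
  and boundedness of \<open>g\<close>.\<close>

lemma fourier_inversion:
  fixes g :: "'a::euclidean_space \<Rightarrow> complex"
  assumes cont: "continuous_on UNIV g" and bdd: "\<And>x. norm (g x) \<le> C"
    and g: "integrable lborel g" and gh: "integrable lborel (fourier g)"
  shows "inverse_fourier (fourier g) x = g x"
proof -
  define e where "e k = 1 / real (Suc k)" for k
  have e0: "0 < e k" for k by (simp add: e_def)
  have elim: "e \<longlonglongrightarrow> 0" unfolding e_def by (rule LIMSEQ_Suc[OF lim_1_over_n])
  let ?s = "complex_of_real (sqrt (2 * pi) ^ DIM('a))"
  have [measurable]: "g \<in> borel_measurable borel" "fourier g \<in> borel_measurable borel"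
    using g gh by auto
  have gi: "integrable lborel (gaussian :: 'a \<Rightarrow> complex)"
    using gaussian_integral(1)[of "0::'a"] by simp
  have gi': "integrable lborel (\<lambda>\<xi>::'a. gaussian (e k *\<^sub>R \<xi>))" for k
    using lborel_integrable_affine[OF gi e0, of 0 k] by simp
  define I where "I k = (LINT \<xi>|lborel. cis (x \<bullet> \<xi>) * fourier g \<xi> * gaussian (e k *\<^sub>R \<xi>))" for k
  \<comment> \<open>Rescaling \<open>\<xi>\<close> absorbs the Jacobian of the substitution
    \<open>z = x + e k *\<^sub>R w\<close>; what remains is a Gaussian in \<open>w\<close> that does
    not depend on \<open>k\<close>.\<close>
  have inner: "of_real (e k ^ DIM('a)) * (LINT \<xi>|lborel. cis (- (w \<bullet> (e k *\<^sub>R \<xi>))) * gaussian (e k *\<^sub>R \<xi>))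
      = ?s * gaussian w" for k and w :: 'a
  proof -
    have "of_real (e k ^ DIM('a)) * (LINT \<xi>|lborel. cis (- (w \<bullet> (e k *\<^sub>R \<xi>))) * gaussian (e k *\<^sub>R \<xi>))
        = (LINT \<xi>|lborel. cis (- (w \<bullet> \<xi>)) * gaussian \<xi>)"
      using lborel_integral_affine[OF _ e0, of "\<lambda>\<xi>. cis (- (w \<bullet> \<xi>)) * gaussian \<xi>" k 0]
      by simp
    also have "\<dots> = ?s * gaussian (- w)"
      using gaussian_integral(2)[of "- w"] by (simp add: inner_commute)
    finally show ?thesis by (simp add: gaussian_def)
  qed
  have I_eq: "I k = ?s * (LINT w|lborel. g (x + e k *\<^sub>R w) * gaussian w)" for k
  proof -
    have "I k = (LINT \<xi>|lborel. gaussian (e k *\<^sub>R \<xi>) * (LINT z|lborel. (cis (x \<bullet> \<xi>) * cis (- (z \<bullet> \<xi>))) * g z))"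
      unfolding I_def fourier_def
      by (simp flip: integral_mult_right_zero add: mult_ac)
    also have "\<dots> = (LINT z|lborel. g z * (LINT \<xi>|lborel. (cis (x \<bullet> \<xi>) * cis (- (z \<bullet> \<xi>))) * gaussian (e k *\<^sub>R \<xi>)))"
      using gi' g by (rule Fubini_kernel)
        (auto simp: norm_mult split_beta' intro!: borel_measurable_continuous_onI continuous_intros)
    also have "\<dots> = of_real (e k ^ DIM('a)) * (LINT w|lborel. g (x + e k *\<^sub>R w) *
        (LINT \<xi>|lborel. (cis (x \<bullet> \<xi>) * cis (- ((x + e k *\<^sub>R w) \<bullet> \<xi>))) * gaussian (e k *\<^sub>R \<xi>)))"
      by (rule lborel_integral_affine[OF _ e0]) measurable
    also have "\<dots> = (LINT w|lborel. g (x + e k *\<^sub>R w) * (of_real (e k ^ DIM('a)) *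
        (LINT \<xi>|lborel. cis (- (w \<bullet> (e k *\<^sub>R \<xi>))) * gaussian (e k *\<^sub>R \<xi>))))"
      by (simp flip: integral_mult_right_zero add: mult_ac cis_mult inner_add_left)
    also have "\<dots> = ?s * (LINT w|lborel. g (x + e k *\<^sub>R w) * gaussian w)"
      unfolding inner by (simp flip: integral_mult_right_zero add: mult_ac)
    finally show ?thesis .
  qed
  have "I \<longlonglongrightarrow> (LINT \<xi>|lborel. cis (x \<bullet> \<xi>) * fourier g \<xi>)"
    unfolding I_def
  proof (rule integral_dominated_convergence[where w="\<lambda>\<xi>. norm (fourier g \<xi>)"])
    show "AE \<xi> in lborel. (\<lambda>k. cis (x \<bullet> \<xi>) * fourier g \<xi> * gaussian (e k *\<^sub>R \<xi>)) \<longlonglongrightarrow> cis (x \<bullet> \<xi>) * fourier g \<xi>"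
    proof (intro AE_I2)
      fix \<xi> :: 'a
      have h: "(\<lambda>k. gaussian (e k *\<^sub>R \<xi>)) \<longlonglongrightarrow> complex_of_real (exp (- ((0 *\<^sub>R \<xi>) \<bullet> (0 *\<^sub>R \<xi>)) / 2))"
        unfolding gaussian_def by (intro tendsto_intros elim) auto
      show "(\<lambda>k. cis (x \<bullet> \<xi>) * fourier g \<xi> * gaussian (e k *\<^sub>R \<xi>)) \<longlonglongrightarrow> cis (x \<bullet> \<xi>) * fourier g \<xi>"
        using tendsto_mult_left[OF h, of "cis (x \<bullet> \<xi>) * fourier g \<xi>"] by simp
    qed
    show "AE \<xi> in lborel. norm (cis (x \<bullet> \<xi>) * fourier g \<xi> * gaussian (e k *\<^sub>R \<xi>)) \<le> norm (fourier g \<xi>)" for k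
      by (auto simp: norm_mult intro!: mult_right_le_one_le gaussian_norm_le)
  qed (use gh in auto)
  moreover have "I \<longlonglongrightarrow> ?s * (LINT w|lborel. g x * gaussian (w::'a))"
    unfolding I_eq
  proof (intro tendsto_mult_left integral_dominated_convergence[where w="\<lambda>w. C * norm (gaussian w)"])
    show "AE w in lborel. (\<lambda>k. g (x + e k *\<^sub>R w) * gaussian w) \<longlonglongrightarrow> g x * gaussian w"
    proof (intro AE_I2 tendsto_mult_right)
      fix w
      have "(\<lambda>k. x + e k *\<^sub>R w) \<longlonglongrightarrow> x + 0 *\<^sub>R w"
        by (intro tendsto_intros elim)
      then have "(\<lambda>k. g (x + e k *\<^sub>R w)) \<longlonglongrightarrow> g (x + 0 *\<^sub>R w)"
        using cont by (intro isCont_tendsto_compose[of _ g]) (auto simp: continuous_on_eq_continuous_at)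
      then show "(\<lambda>k. g (x + e k *\<^sub>R w)) \<longlonglongrightarrow> g x" by simp
    qed
    show "AE w in lborel. norm (g (x + e k *\<^sub>R w) * gaussian w) \<le> C * norm (gaussian w)" for k
      by (auto simp: norm_mult intro!: mult_right_mono bdd)
  qed (use gi in auto)
  \<comment> \<open>One factor \<open>?s\<close> comes from the transform of the Gaussian, the other
    from its total mass; together they give the constant that \<open>inverse_fourier\<close> divides
    by.\<close>
  moreover have "?s * (LINT w|lborel. g x * gaussian (w::'a)) = of_real ((2 * pi) ^ DIM('a)) * g x"
  proof -
    have "(LINT w|lborel. gaussian (w::'a)) = ?s"
      using gaussian_integral(2)[of "0::'a"] by (simp add: gaussian_def)
    moreover have "?s * ?s = of_real ((2 * pi) ^ DIM('a))"
      unfolding of_real_mult[symmetric] power_mult_distrib[symmetric] by simp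
    ultimately show ?thesis by (simp only: integral_mult_right_zero mult.left_commute[of ?s "g x"]) (simp add: mult.commute)
  qed
  ultimately have "(LINT \<xi>|lborel. cis (x \<bullet> \<xi>) * fourier g \<xi>) = of_real ((2 * pi) ^ DIM('a)) * g x"
    by (metis LIMSEQ_unique)
  then show ?thesis
    by (simp add: inverse_fourier_def)
qed

section \<open>Test functions\<close>

text \<open>Guarantees that derivatives within \<open>S\<close> are unique, so that \<open>frechet_derivative\<close> is not a
  junk value.\<close>

definition ample :: "'a::euclidean_space set \<Rightarrow> bool" where
  "ample S \<longleftrightarrow> closed S \<and>
     (\<forall>x\<in>S. \<forall>i\<in>Basis. \<forall>e>0. \<exists>d. 0 < \<bar>d\<bar> \<and> \<bar>d\<bar> < e \<and> x + d *\<^sub>R i \<in> S)"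

lemma ample_UNIV: "ample (UNIV :: 'a::euclidean_space set)"
proof -
  have "\<exists>d. 0 < \<bar>d\<bar> \<and> \<bar>d\<bar> < e \<and> x + d *\<^sub>R i \<in> UNIV" if "0 < e" for e and x i :: 'a
    using that by (intro exI[of _ "e / 2"]) auto
  then show ?thesis
    unfolding ample_def by auto
qed

section \<open>Calculus of partial derivatives within an ample set\<close>

lemma dderiv_eqI:
  assumes "ample S" "p \<in> S" "(u has_derivative u') (at p within S)"
  shows "dderiv S b u p = u' b"
proof -
  have "(u has_derivative frechet_derivative u (at p within S)) (at p within S)"
    using assms(3) by (metis differentiableI frechet_derivative_works)
  then have "frechet_derivative u (at p within S) = u'"
    using assms unfolding ample_def
    by (intro frechet_derivative_unique_within[OF _ assms(3)]) blast+
  then show ?thesis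
    by (simp add: dderiv_def)
qed

text \<open>\<open>frechet_derivative\<close> is a choice among the candidate derivatives, and
  functions that agree on \<open>S\<close> have the same candidates.\<close>

lemma dderiv_cong:
  assumes "p \<in> S" "\<And>q. q \<in> S \<Longrightarrow> u q = v q"
  shows "dderiv S b u p = dderiv S b v p"
proof -
  have "(u has_derivative D) (at p within S) \<longleftrightarrow> (v has_derivative D) (at p within S)" for D
    using assms by (metis has_derivative_transform)
  then show ?thesis
    unfolding dderiv_def frechet_derivative_def by simp
qed

lemma dderiv_zero:
  assumes S: "ample S" and p: "p \<in> S" and "0 < d" "\<And>q. q \<in> S \<Longrightarrow> dist q p < d \<Longrightarrow> u q = 0"
  shows "dderiv S b u p = 0"
proof -
  have "(u has_derivative (\<lambda>_. 0)) (at p within S)"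
    using assms by (intro has_derivative_transform_within[OF has_derivative_const[of 0]]) auto
  then show ?thesis
    using S p by (simp add: dderiv_eqI)
qed

lemma dderiv_lincomb:
  assumes S: "ample S" and p: "p \<in> S"
    and "u differentiable (at p within S)" "v differentiable (at p within S)"
  shows "dderiv S b (\<lambda>q. c * u q + d * v q) p = c * dderiv S b u p + d * dderiv S b v p"
proof -
  from assms obtain u' v' where d: "(u has_derivative u') (at p within S)"
      "(v has_derivative v') (at p within S)"
    unfolding differentiable_def by blast
  have "((\<lambda>q. c * u q + d * v q) has_derivative (\<lambda>h. c * u' h + d * v' h)) (at p within S)"
    by (intro derivative_intros d)
  then show ?thesis
    using dderiv_eqI[OF S p] d by simp
qed

lemma dderiv_sum:
  assumes S: "ample S" and p: "p \<in> S"
    and g: "\<And>a. a \<in> A \<Longrightarrow> g a differentiable (at p within S)"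
  shows "dderiv S b (\<lambda>q. \<Sum>a\<in>A. g a q) p = (\<Sum>a\<in>A. dderiv S b (g a) p)"
proof -
  have "((\<lambda>q. \<Sum>a\<in>A. g a q) has_derivative
      (\<lambda>h. \<Sum>a\<in>A. frechet_derivative (g a) (at p within S) h)) (at p within S)"
    using g by (intro has_derivative_sum) (simp add: frechet_derivative_works)
  then show ?thesis
    using dderiv_eqI[OF S p] by (simp add: dderiv_def)
qed

text \<open>The bridge from \<open>dderiv\<close> to one-variable calculus: \<open>T\<close>
  collects parameters for which the line stays in \<open>S\<close>, for instance a half line in the
  normal direction, where the derivative at 0 is one-sided.\<close>

lemma dderiv_path:
  assumes u: "u differentiable (at (p + t *\<^sub>R b) within S)" and T: "\<And>s. s \<in> T \<Longrightarrow> p + s *\<^sub>R b \<in> S"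
  shows "((\<lambda>s. u (p + s *\<^sub>R b)) has_vector_derivative dderiv S b u (p + t *\<^sub>R b)) (at t within T)"
proof -
  let ?D = "frechet_derivative u (at (p + t *\<^sub>R b) within S)"
  have D: "(u has_derivative ?D) (at (p + t *\<^sub>R b) within S)"
    using u by (simp add: frechet_derivative_works)
  have "((\<lambda>s. u (p + s *\<^sub>R b)) has_derivative (\<lambda>h. ?D (h *\<^sub>R b))) (at t within T)"
  proof (rule has_derivative_in_compose[where f="\<lambda>s. p + s *\<^sub>R b" and f'="\<lambda>h. h *\<^sub>R b" and g=u and g'="?D"])
    show "((\<lambda>s. p + s *\<^sub>R b) has_derivative (\<lambda>h. h *\<^sub>R b)) (at t within T)"
      by (auto intro!: derivative_eq_intros)
    show "(u has_derivative ?D) (at (p + t *\<^sub>R b) within (\<lambda>s. p + s *\<^sub>R b) ` T)"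
      using T by (intro has_derivative_subset[OF D]) auto
  qed
  then show ?thesis
    using linear_scale[OF has_derivative_linear[OF D]]
    by (simp add: has_vector_derivative_def dderiv_def)
qed

lemma smooth_on_dderiv:
  assumes u: "smooth_on S u" and b: "b \<in> Basis"
  shows "smooth_on S (dderiv S b u)"
  unfolding smooth_on_def
proof (intro allI impI)
  fix bs assume "set bs \<subseteq> (Basis :: 'a set)"
  \<comment> \<open>\<open>foldr\<close> applies the last entry first, so the derivative already
    taken goes to the end of the list.\<close>
  then have "set (bs @ [b]) \<subseteq> Basis"
    using b by simp
  then have "foldr (dderiv S) (bs @ [b]) u differentiable_on S"
    using u unfolding smooth_on_def by blast
  then show "foldr (dderiv S) bs (dderiv S b u) differentiable_on S"
    by simp
qed

lemma smooth_on_differentiable: "smooth_on S u \<Longrightarrow> p \<in> S \<Longrightarrow> u differentiable (at p within S)"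
  unfolding smooth_on_def differentiable_on_def
  by (metis empty_subsetI foldr_Nil id_apply list.set(1))

lemma smooth_on_continuous: "smooth_on S u \<Longrightarrow> continuous_on S u"
  by (simp add: continuous_on_eq_continuous_within differentiable_imp_continuous_within
      smooth_on_differentiable)

text \<open>A point off the closed support of \<open>u\<close> has a neighbourhood in
  \<open>S\<close> on which \<open>u\<close> vanishes, so differentiation does not enlarge the
  support.\<close>

lemma test_functions_dderiv:
  assumes S: "ample S" and u: "u \<in> test_functions S" and b: "b \<in> Basis"
  shows "dderiv S b u \<in> test_functions S"
proof -
  let ?K = "closure {p \<in> S. u p \<noteq> 0}"
  have "p \<in> ?K" if p: "p \<in> S" "dderiv S b u p \<noteq> 0" for p
  proof (rule ccontr)
    assume "p \<notin> ?K"
    then obtain e where e: "0 < e" "ball p e \<subseteq> - ?K"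
      by (meson ComplI closed_closure open_Compl open_contains_ball)
    have "u q = 0" if "q \<in> S" "dist q p < e" for q
      using that e(2) closure_subset[of "{p \<in> S. u p \<noteq> 0}"]
      by (auto simp: dist_commute subset_iff)
    then show False
      using dderiv_zero[OF S p(1) e(1)] p(2) by blast
  qed
  then have "closure {p \<in> S. dderiv S b u p \<noteq> 0} \<subseteq> ?K"
    by (intro closure_minimal) auto
  moreover have "compact ?K"
    using u by (simp add: test_functions_def)
  ultimately have "bounded (closure {p \<in> S. dderiv S b u p \<noteq> 0})"
    using bounded_subset compact_imp_bounded by blast
  then have "compact (closure {p \<in> S. dderiv S b u p \<noteq> 0})"
    by (simp add: compact_eq_bounded_closed)
  then show ?thesis
    using u b by (simp add: test_functions_def smooth_on_dderiv)
qed

lemma test_functions_support: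
  assumes "u \<in> test_functions S"
  shows "\<exists>R. \<forall>p\<in>S. R \<le> norm p \<longrightarrow> u p = 0"
proof -
  have "bounded {p \<in> S. u p \<noteq> 0}"
    using assms by (simp add: test_functions_def compact_closure)
  then obtain R where "\<And>p. p \<in> {p \<in> S. u p \<noteq> 0} \<Longrightarrow> norm p \<le> R"
    by (auto simp: bounded_iff)
  \<comment> \<open>Points of norm exactly \<open>R\<close> may still lie in the support, hence the
    shift by 1.\<close>
  then have "\<forall>p\<in>S. R + 1 \<le> norm p \<longrightarrow> u p = 0"
    by force
  then show ?thesis ..
qed

lemma test_functions_smooth: "u \<in> test_functions S \<Longrightarrow> smooth_on S u"
  by (simp add: test_functions_def)

lemma test_functionsI:
  assumes S: "closed S" and u: "smooth_on S u" and "\<And>p. p \<in> S \<Longrightarrow> R \<le> norm p \<Longrightarrow> u p = 0"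
  shows "u \<in> test_functions S"
proof -
  have "{p \<in> S. u p \<noteq> 0} \<subseteq> cball 0 R"
    using assms(3) by force
  then have "bounded {p \<in> S. u p \<noteq> 0}"
    using bounded_cball bounded_subset by blast
  then show ?thesis
    using u by (simp add: test_functions_def compact_closure)
qed

lemma foldr_dderiv_lincomb:
  assumes u: "smooth_on UNIV u" and v: "smooth_on UNIV v" and bs: "set bs \<subseteq> Basis"
  shows "foldr (dderiv UNIV) bs (\<lambda>p. c * u p + d * v p) =
    (\<lambda>p. c * foldr (dderiv UNIV) bs u p + d * foldr (dderiv UNIV) bs v p)"
  using bs
proof (induction bs)
  case (Cons b bs)
  have "foldr (dderiv UNIV) bs u differentiable (at p)" "foldr (dderiv UNIV) bs v differentiable (at p)" for p
    using u v Cons.prems unfolding smooth_on_def differentiable_on_def by auto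
  then have "dderiv UNIV b (\<lambda>p. c * foldr (dderiv UNIV) bs u p + d * foldr (dderiv UNIV) bs v p) p =
      c * dderiv UNIV b (foldr (dderiv UNIV) bs u) p + d * dderiv UNIV b (foldr (dderiv UNIV) bs v) p" for p
    by (intro dderiv_lincomb ample_UNIV) auto
  then show ?case
    using Cons by auto
qed simp

lemma test_functions_lincomb:
  assumes u: "u \<in> test_functions UNIV" and v: "v \<in> test_functions UNIV"
  shows "(\<lambda>p. c * u p + d * v p) \<in> test_functions UNIV"
proof -
  obtain R where R: "\<And>p. R \<le> norm p \<Longrightarrow> u p = 0"
    using test_functions_support[OF u] by auto
  obtain R' where R': "\<And>p. R' \<le> norm p \<Longrightarrow> v p = 0"
    using test_functions_support[OF v] by auto
  have su: "smooth_on UNIV u" and sv: "smooth_on UNIV v"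
    using u v by (auto simp: test_functions_def)
  show ?thesis
  proof (rule test_functionsI[where R="max R R'"])
    show "smooth_on UNIV (\<lambda>p. c * u p + d * v p)"
      using su sv unfolding smooth_on_def[of UNIV "\<lambda>p. c * u p + d * v p"]
      by (auto simp: foldr_dderiv_lincomb smooth_on_def differentiable_on_def
          intro!: differentiable_add differentiable_mult)
  qed (auto simp: R R')
qed

section \<open>Integrals of compactly supported functions\<close>

lemma compact_support_integral:
  fixes h :: "'a::euclidean_space \<Rightarrow> complex"
  assumes h: "continuous_on UNIV h" and supp: "\<And>x. x \<notin> cbox a b \<Longrightarrow> h x = 0"
  shows "integrable lborel h" and "(LINT x|lborel. h x) = integral (cbox a b) h"
proof -
  have eq: "(\<lambda>x. indicator (cbox a b) x *\<^sub>R h x) = h"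
    using supp by (auto simp: fun_eq_iff indicator_def)
  show int: "integrable lborel h"
    using borel_integrable_compact[OF compact_cbox continuous_on_subset[OF h], of a b] eq by simp
  have "(LINT x|lborel. h x) = integral UNIV h"
    using integral_lborel[OF int] by simp
  also have "integral UNIV h = integral UNIV (\<lambda>x. if x \<in> cbox a b then h x else 0)"
    using supp by (intro arg_cong[where f="integral UNIV"]) auto
  also have "\<dots> = integral (cbox a b) h"
    by (rule integral_restrict_UNIV)
  finally show "(LINT x|lborel. h x) = integral (cbox a b) h" .
qed

text \<open>The common box turns integrals over the whole space into integrals over a compact set,
  where joint continuity of the derivative suffices. \<open>U\<close> is any convex set, so that
  \<open>U = {0..}\<close> yields one-sided derivatives at the boundary.\<close>

lemma leibniz_lborel:
  fixes \<phi> \<phi>' :: "real \<Rightarrow> 'a::euclidean_space \<Rightarrow> complex"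
  assumes deriv: "\<And>t x. t \<in> U \<Longrightarrow> ((\<lambda>t. \<phi> t x) has_vector_derivative \<phi>' t x) (at t within U)"
    and cont: "\<And>t. t \<in> U \<Longrightarrow> continuous_on UNIV (\<phi> t)"
    and cont': "continuous_on (U \<times> UNIV) (\<lambda>(t, x). \<phi>' t x)"
    and supp: "\<And>t x. t \<in> U \<Longrightarrow> x \<notin> cbox a b \<Longrightarrow> \<phi> t x = 0 \<and> \<phi>' t x = 0"
    and U: "t0 \<in> U" "convex U"
  shows "((\<lambda>t. LINT x|lborel. \<phi> t x) has_vector_derivative (LINT x|lborel. \<phi>' t0 x)) (at t0 within U)"
proof -
  have "continuous_on UNIV (\<lambda>x. case (t, x) of (t, x) \<Rightarrow> \<phi>' t x)" if "t \<in> U" for t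
    using that by (intro continuous_on_compose2[OF cont'] continuous_intros) auto
  then have c': "continuous_on UNIV (\<phi>' t)" if "t \<in> U" for t
    using that by simp
  have "((\<lambda>t. integral (cbox a b) (\<phi> t)) has_vector_derivative integral (cbox a b) (\<phi>' t0)) (at t0 within U)"
    using deriv cont U
    by (intro leibniz_rule_vector_derivative continuous_on_subset[OF cont'])
      (auto intro!: integrable_continuous intro: continuous_on_subset)
  then have "((\<lambda>t. LINT x|lborel. \<phi> t x) has_vector_derivative integral (cbox a b) (\<phi>' t0)) (at t0 within U)"
    by (rule has_vector_derivative_transform[rotated 2])
      (use U supp in \<open>auto intro!: compact_support_integral(2) cont\<close>)
  then show ?thesis
    using U supp by (subst compact_support_integral(2)[OF c']) auto
qed

section \<open>Fourier transforms of test functions\<close>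

abbreviation ft :: "('a::euclidean_space \<Rightarrow> real) \<Rightarrow> 'a \<Rightarrow> complex" where
  "ft g \<equiv> fourier (\<lambda>x. of_real (g x))"

lemma test_function_bounds:
  fixes g :: "'a::euclidean_space \<Rightarrow> real"
  assumes g: "g \<in> test_functions UNIV"
  shows "continuous_on UNIV g" "integrable lborel (\<lambda>x. complex_of_real (g x))"
    "\<exists>C. \<forall>x. norm (g x) \<le> C" "\<exists>C. \<forall>\<xi>. norm (ft g \<xi>) \<le> C"
proof -
  show c: "continuous_on UNIV g"
    using g by (simp add: test_functions_def smooth_on_continuous)
  obtain R where R: "\<And>p. R \<le> norm p \<Longrightarrow> g p = 0"
    using test_functions_support[OF g] by auto
  obtain a where a: "cball 0 R \<subseteq> cbox (- a) (a :: 'a)"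
    using bounded_subset_cbox_symmetric[OF bounded_cball] by blast
  have z: "g x = 0" if "x \<notin> cbox (- a) a" for x
    using R[of x] a that by (meson in_mono linorder_linear mem_cball_0)
  show int: "integrable lborel (\<lambda>x. complex_of_real (g x))"
    by (rule compact_support_integral(1)[of _ "- a" a]) (auto intro!: continuous_intros c simp: z)
  have "bounded (g ` cbox (- a) a)"
    by (intro compact_imp_bounded compact_continuous_image continuous_on_subset[OF c]) auto
  then obtain C where C: "0 < C" "\<And>x. x \<in> cbox (- a) a \<Longrightarrow> norm (g x) \<le> C"
    by (auto simp: bounded_pos)
  have "norm (g x) \<le> C" for x
    using C z[of x] by (cases "x \<in> cbox (- a) a") auto
  then show "\<exists>C. \<forall>x. norm (g x) \<le> C" by blast
  have "norm (ft g \<xi>) \<le> (LINT x|lborel. norm (g x))" for \<xi>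
    unfolding fourier_def
    by (rule order_trans[OF integral_norm_bound]) (simp add: norm_mult)
  then show "\<exists>C. \<forall>\<xi>. norm (ft g \<xi>) \<le> C" by blast
qed

lemma fourier_measurable [measurable]:
  fixes g :: "'a::euclidean_space \<Rightarrow> complex"
  assumes [measurable]: "g \<in> borel_measurable borel"
  shows "fourier g \<in> borel_measurable borel"
  unfolding fourier_def by measurable

lemma ft_integrand_integrable:
  fixes g :: "'a::euclidean_space \<Rightarrow> real"
  assumes g: "g \<in> test_functions UNIV"
  shows "integrable lborel (\<lambda>x. cis (- (x \<bullet> \<xi>)) * complex_of_real (g x))"
proof (rule Bochner_Integration.integrable_bound[OF test_function_bounds(2)[OF g]])
  have [measurable]: "g \<in> borel_measurable borel"
    using test_function_bounds(1)[OF g] by (rule borel_measurable_continuous_onI)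
  show "(\<lambda>x. cis (- (x \<bullet> \<xi>)) * complex_of_real (g x)) \<in> borel_measurable lborel"
    by simp
qed (simp add: norm_mult)

lemma ft_lincomb:
  fixes u v :: "'a::euclidean_space \<Rightarrow> real"
  assumes u: "u \<in> test_functions UNIV" and v: "v \<in> test_functions UNIV"
  shows "ft (\<lambda>x. c * u x + d * v x) \<xi> = of_real c * ft u \<xi> + of_real d * ft v \<xi>"
proof -
  have "ft (\<lambda>x. c * u x + d * v x) \<xi> = (LINT x|lborel. of_real c * (cis (- (x \<bullet> \<xi>)) * u x) +
      of_real d * (cis (- (x \<bullet> \<xi>)) * v x))"
    unfolding fourier_def by (simp add: algebra_simps)
  also have "\<dots> = of_real c * ft u \<xi> + of_real d * ft v \<xi>"
    using ft_integrand_integrable[OF u, of \<xi>] ft_integrand_integrable[OF v, of \<xi>]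
    unfolding fourier_def by simp
  finally show ?thesis .
qed

text \<open>Differentiate \<open>fourier (g (\<cdot> + t b)) = cis (t b \<bullet> \<xi>) * fourier g\<close> at \<open>t = 0\<close>.\<close>

lemma ft_dderiv:
  fixes g :: "'a::euclidean_space \<Rightarrow> real"
  assumes g: "g \<in> test_functions UNIV" and b: "b \<in> Basis"
  shows "ft (dderiv UNIV b g) \<xi> = \<i> * of_real (\<xi> \<bullet> b) * ft g \<xi>"
proof -
  \<comment> \<open>A bounded parameter interval keeps all translates inside one box, whose radius
    is enlarged by 1 for this purpose; 0 is an interior point, so the derivative there is
    two-sided.\<close>
  let ?U = "{-1..1} :: real set"
  let ?\<phi> = "\<lambda>t x. cis (- (x \<bullet> \<xi>)) * complex_of_real (g (x + t *\<^sub>R b))"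
  let ?\<phi>' = "\<lambda>t x. cis (- (x \<bullet> \<xi>)) * complex_of_real (dderiv UNIV b g (x + t *\<^sub>R b))"
  have dg: "dderiv UNIV b g \<in> test_functions UNIV"
    using g b by (simp add: test_functions_dderiv ample_UNIV)
  note c = test_function_bounds(1)[OF g] and c' = test_function_bounds(1)[OF dg]
  have [measurable]: "g \<in> borel_measurable borel"
    using c by (rule borel_measurable_continuous_onI)
  obtain R where R: "\<And>p. R \<le> norm p \<Longrightarrow> g p = 0"
    using test_functions_support[OF g] by auto
  obtain R' where R': "\<And>p. R' \<le> norm p \<Longrightarrow> dderiv UNIV b g p = 0"
    using test_functions_support[OF dg] by auto
  obtain a where a: "cball 0 (max R R' + 1) \<subseteq> cbox (- a) (a :: 'a)"
    using bounded_subset_cbox_symmetric[OF bounded_cball] by blast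
  have "((\<lambda>t. LINT x|lborel. ?\<phi> t x) has_vector_derivative (LINT x|lborel. ?\<phi>' 0 x)) (at 0 within ?U)"
  proof (rule leibniz_lborel[where a="- a" and b=a])
    show "((\<lambda>t. ?\<phi> t x) has_vector_derivative ?\<phi>' t x) (at t within ?U)" for t x
    proof -
      have "g differentiable (at p within UNIV)" for p
        by (rule smooth_on_differentiable[OF test_functions_smooth[OF g]]) simp
      then have "((\<lambda>t. g (x + t *\<^sub>R b)) has_vector_derivative dderiv UNIV b g (x + t *\<^sub>R b)) (at t within ?U)"
        by (rule dderiv_path) simp
      then show ?thesis
        by (intro has_vector_derivative_mult_right has_vector_derivative_of_real)
          (simp add: has_real_derivative_iff_has_vector_derivative)
    qed
    show "continuous_on UNIV (?\<phi> t)" for t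
      by (intro continuous_intros continuous_on_compose2[OF c]) auto
    show "continuous_on (?U \<times> UNIV) (\<lambda>(t, x). ?\<phi>' t x)"
      unfolding split_beta' by (intro continuous_intros continuous_on_compose2[OF c']) auto
    show "?\<phi> t x = 0 \<and> ?\<phi>' t x = 0" if "t \<in> ?U" "x \<notin> cbox (- a) a" for t x
    proof -
      have "max R R' + 1 < norm x"
        using a that(2) by (meson in_mono linorder_not_less mem_cball_0)
      moreover have "norm x \<le> norm (x + t *\<^sub>R b) + norm (t *\<^sub>R b)"
        by (metis add_diff_cancel_right' norm_triangle_ineq4)
      moreover have "norm (t *\<^sub>R b) \<le> 1"
        using b that(1) by auto
      ultimately show ?thesis
        by (simp add: R R')
    qed
  qed auto
  moreover have "(LINT x|lborel. ?\<phi> t x) = cis (t * (\<xi> \<bullet> b)) * ft g \<xi>" for t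
  proof -
    have "cis (t * (\<xi> \<bullet> b)) * ft g \<xi> = (LINT z|lborel. cis (t * (\<xi> \<bullet> b)) * (cis (- (z \<bullet> \<xi>)) * g z))"
      unfolding fourier_def by simp
    also have "\<dots> = (LINT x|lborel. cis (t * (\<xi> \<bullet> b)) * (cis (- ((t *\<^sub>R b + x) \<bullet> \<xi>)) * g (t *\<^sub>R b + x)))"
      using lborel_integral_affine[of "\<lambda>z. cis (t * (\<xi> \<bullet> b)) * (cis (- (z \<bullet> \<xi>)) * g z)" 1 "t *\<^sub>R b"]
      by simp
    also have "\<dots> = (LINT x|lborel. ?\<phi> t x)"
      by (intro Bochner_Integration.integral_cong)
        (auto simp: cis_mult inner_add_left inner_add_right inner_commute add_ac simp flip: mult.assoc)
    finally show ?thesis by simp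
  qed
  ultimately have 1: "((\<lambda>t. cis (t * (\<xi> \<bullet> b)) * ft g \<xi>) has_vector_derivative ft (dderiv UNIV b g) \<xi>) (at 0)"
    by (simp add: fourier_def at_within_Icc_at)
  have 2: "((\<lambda>t. cis (t * (\<xi> \<bullet> b)) * ft g \<xi>) has_vector_derivative (\<i> * of_real (\<xi> \<bullet> b)) * ft g \<xi>) (at 0)"
  proof -
    have "((\<lambda>t. cis (t * (\<xi> \<bullet> b))) has_vector_derivative (\<xi> \<bullet> b) *\<^sub>R (\<i> * cis (0 * (\<xi> \<bullet> b)))) (at 0)"
      unfolding has_vector_derivative_def
      by (auto intro!: derivative_eq_intros)
    then show ?thesis
      by (intro has_vector_derivative_mult_left) (simp add: scaleR_conv_of_real mult.commute)
  qed
  show ?thesis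
    using vector_derivative_unique_at[OF 1 2] .
qed

section \<open>Decay of the Fourier transform and the Parseval identity\<close>

lemma one_plus_sum_le_prod:
  fixes a :: "'b \<Rightarrow> real"
  assumes "finite B" "\<And>b. b \<in> B \<Longrightarrow> 0 \<le> a b"
  shows "1 + (\<Sum>b\<in>B. a b) \<le> (\<Prod>b\<in>B. 1 + a b)"
  using assms
proof (induction B rule: finite_induct)
  case (insert b B)
  then have IH: "1 + (\<Sum>b\<in>B. a b) \<le> (\<Prod>b\<in>B. 1 + a b)" and "0 \<le> a b" and "0 \<le> (\<Sum>b\<in>B. a b)"
    by (auto intro: sum_nonneg)
  then have "1 + (a b + (\<Sum>b\<in>B. a b)) \<le> (1 + a b) * (1 + (\<Sum>b\<in>B. a b))"
    by (simp add: algebra_simps)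
  also have "\<dots> \<le> (1 + a b) * (\<Prod>b\<in>B. 1 + a b)"
    using IH \<open>0 \<le> a b\<close> by (intro mult_left_mono) auto
  finally show ?case
    using insert by simp
qed simp

text \<open>A product instead of a power of \<open>1 + (norm \<xi>)\<^sup>2\<close>: its inverse is
  integrable by one-dimensional integrals in every dimension, and it is the symbol of the product of
  the operators \<open>1 - \<partial>\<^sub>b\<^sup>2\<close>, so no fractional powers
  arise.\<close>

definition weight :: "'a::euclidean_space \<Rightarrow> real" where
  "weight \<xi> = (\<Prod>b\<in>Basis. 1 + (\<xi> \<bullet> b)\<^sup>2)"

lemma weight_ge: "1 + (norm \<xi>)\<^sup>2 \<le> weight \<xi>"
proof -
  have "(norm \<xi>)\<^sup>2 = (\<Sum>b\<in>Basis. (\<xi> \<bullet> b)\<^sup>2)"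
    unfolding power2_norm_eq_inner by (subst euclidean_inner) (simp add: power2_eq_square)
  then show ?thesis
    unfolding weight_def using one_plus_sum_le_prod[of Basis "\<lambda>b. (\<xi> \<bullet> b)\<^sup>2"] by simp
qed

lemma integrable_inverse_weight:
  "integrable lborel (\<lambda>\<xi>::'a::euclidean_space. complex_of_real (1 / weight \<xi>))"
proof -
  have "integrable lborel (\<lambda>t::real. inverse (1 + t\<^sup>2))"
    using integrable_inverse_1_plus_square by (simp add: set_integrable_def)
  then have "integrable lborel (\<lambda>t::real. complex_of_real (inverse (1 + t\<^sup>2)))"
    by (rule integrable_of_real)
  then have "integrable lborel (\<lambda>\<xi>::'a. \<Prod>b\<in>Basis. complex_of_real (inverse (1 + (\<xi> \<bullet> b)\<^sup>2)))"
    by (rule lborel_prod_Basis(1))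
  then show ?thesis
    by (simp add: weight_def inverse_eq_divide prod_dividef)
qed

text \<open>Each factor is the symbol of \<open>1 - \<partial>\<^sub>b\<^sup>2\<close>, which maps
  test functions to test functions; the induction composes these operators over
  \<open>B\<close>.\<close>

lemma ft_weight_partial:
  fixes g :: "'a::euclidean_space \<Rightarrow> real"
  assumes g: "g \<in> test_functions UNIV" and B: "B \<subseteq> Basis"
  shows "\<exists>h \<in> test_functions UNIV. \<forall>\<xi>. ft h \<xi> = of_real (\<Prod>b\<in>B. 1 + (\<xi> \<bullet> b)\<^sup>2) * ft g \<xi>"
proof -
  have "finite B"
    using B finite_subset finite_Basis by blast
  from this B show ?thesis
  proof (induction B rule: finite_induct)
    case empty
    then show ?case using g by auto
  next
    case (insert b B)
    then obtain h where h: "h \<in> test_functions UNIV"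
        "\<And>\<xi>. ft h \<xi> = of_real (\<Prod>b\<in>B. 1 + (\<xi> \<bullet> b)\<^sup>2) * ft g \<xi>"
      by auto
    have b: "b \<in> Basis" using insert by simp
    have d: "dderiv UNIV b h \<in> test_functions UNIV" "dderiv UNIV b (dderiv UNIV b h) \<in> test_functions UNIV"
      using h(1) b by (simp_all add: test_functions_dderiv ample_UNIV)
    let ?k = "\<lambda>x. 1 * h x + (-1) * dderiv UNIV b (dderiv UNIV b h) x"
    have "?k \<in> test_functions UNIV"
      by (intro test_functions_lincomb h d)
    moreover have "ft ?k \<xi> = of_real (\<Prod>b\<in>insert b B. 1 + (\<xi> \<bullet> b)\<^sup>2) * ft g \<xi>" for \<xi>
    proof -
      have i2: "\<i> * a * (\<i> * a * z) = - (a * a * z)" for a z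
        by (simp add: complex_eq_iff algebra_simps)
      have "ft ?k \<xi> = ft h \<xi> + (\<xi> \<bullet> b)\<^sup>2 * ft h \<xi>"
        unfolding ft_lincomb[OF h(1) d(2)] ft_dderiv[OF d(1) b] ft_dderiv[OF h(1) b] i2
        by (simp add: power2_eq_square)
      then show ?thesis
        using insert.hyps by (simp add: h(2) algebra_simps)
    qed
    ultimately show ?case
      by (intro bexI[of _ ?k] allI)
  qed
qed

text \<open>Three rounds of the weight operator produce a test function \<open>h3\<close> whose
  transform is the weighted one, and the transform of any test function is bounded.\<close>

lemma ft_decay:
  fixes g :: "'a::euclidean_space \<Rightarrow> real"
  assumes g: "g \<in> test_functions UNIV"
  shows "\<exists>C. \<forall>\<xi>. weight \<xi> ^ 3 * norm (ft g \<xi>) \<le> C"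
proof -
  have W: "\<exists>h \<in> test_functions UNIV. \<forall>\<xi>. ft h \<xi> = of_real (weight \<xi>) * ft g \<xi>"
    if "g \<in> test_functions UNIV" for g :: "'a \<Rightarrow> real"
    using ft_weight_partial[OF that order_refl] by (simp add: weight_def)
  obtain h1 where h1: "h1 \<in> test_functions UNIV" "\<And>\<xi>. ft h1 \<xi> = of_real (weight \<xi>) * ft g \<xi>"
    using W[OF g] by blast
  obtain h2 where h2: "h2 \<in> test_functions UNIV" "\<And>\<xi>. ft h2 \<xi> = of_real (weight \<xi>) * ft h1 \<xi>"
    using W[OF h1(1)] by blast
  obtain h3 where h3: "h3 \<in> test_functions UNIV" "\<And>\<xi>. ft h3 \<xi> = of_real (weight \<xi>) * ft h2 \<xi>"
    using W[OF h2(1)] by blast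
  obtain C where "\<And>\<xi>. norm (ft h3 \<xi>) \<le> C"
    using test_function_bounds(4)[OF h3(1)] by blast
  moreover have "0 \<le> weight \<xi>" for \<xi> :: 'a
    unfolding weight_def by (intro prod_nonneg) auto
  ultimately have "weight \<xi> ^ 3 * norm (ft g \<xi>) \<le> C" for \<xi>
    by (simp add: h1 h2 h3 norm_mult power3_eq_cube mult.assoc)
  then show ?thesis by blast
qed

lemma test_function_measurable:
  "g \<in> test_functions UNIV \<Longrightarrow> g \<in> borel_measurable borel"
  using test_function_bounds(1) by (rule borel_measurable_continuous_onI)

text \<open>Two of the three weights in \<open>ft_decay\<close> absorb
  \<open>norm \<xi> ^ k\<close>, since \<open>1 + (norm \<xi>)\<^sup>2\<close> is at most
  \<open>weight \<xi>\<close>; this explains the bound 4. The third weight leaves the integrable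
  majorant \<open>C / weight \<xi>\<close>.\<close>

lemma ft_integrable:
  fixes g :: "'a::euclidean_space \<Rightarrow> real"
  assumes g: "g \<in> test_functions UNIV" and k: "k \<le> 4"
  shows "integrable lborel (\<lambda>\<xi>. of_real (norm \<xi> ^ k) * ft g \<xi>)"
proof -
  note [measurable] = test_function_measurable[OF g]
  obtain C where C: "\<And>\<xi>. weight \<xi> ^ 3 * norm (ft g \<xi>) \<le> C"
    using ft_decay[OF g] by blast
  have "norm (of_real (norm \<xi> ^ k) * ft g \<xi>) \<le> norm (of_real C * complex_of_real (1 / weight \<xi>))" for \<xi>
  proof -
    let ?w = "weight \<xi>"
    have w1: "1 \<le> ?w"
      using weight_ge[of \<xi>] by (smt (verit) zero_le_power2)
    have "norm \<xi> ^ k \<le> ?w\<^sup>2"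
    proof (cases "norm \<xi> \<le> 1")
      case True
      then have "norm \<xi> ^ k \<le> 1" by (simp add: power_le_one)
      also have "1 \<le> ?w\<^sup>2" using w1 by simp
      finally show ?thesis .
    next
      case False
      then have "norm \<xi> ^ k \<le> norm \<xi> ^ 4" using k by (intro power_increasing) auto
      also have "\<dots> = ((norm \<xi>)\<^sup>2)\<^sup>2" by simp
      also have "\<dots> \<le> ?w\<^sup>2" using weight_ge[of \<xi>] by (intro power_mono) auto
      finally show ?thesis .
    qed
    then have "norm \<xi> ^ k * norm (ft g \<xi>) * ?w \<le> ?w\<^sup>2 * norm (ft g \<xi>) * ?w"
      using w1 by (intro mult_right_mono) auto
    also have "\<dots> = ?w ^ 3 * norm (ft g \<xi>)"
      by (simp add: power2_eq_square power3_eq_cube)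
    also have "\<dots> \<le> C" by (rule C)
    finally have "norm \<xi> ^ k * norm (ft g \<xi>) \<le> C / ?w"
      using w1 by (simp add: field_simps)
    also have "C / ?w \<le> norm (of_real C * complex_of_real (1 / ?w))"
      unfolding of_real_mult[symmetric] norm_of_real times_divide_eq_right mult_1_right
      by (rule abs_ge_self)
    finally show ?thesis
      by (simp add: norm_mult norm_power)
  qed
  then show ?thesis
    by (intro Bochner_Integration.integrable_bound[OF integrable_mult_right[OF integrable_inverse_weight, of "of_real C"]]) auto
qed

section \<open>Inversion and Parseval identities\<close>

lemma ft_inversion:
  fixes g :: "'a::euclidean_space \<Rightarrow> real"
  assumes g: "g \<in> test_functions UNIV"
  shows "inverse_fourier (ft g) x = of_real (g x)"
proof -
  obtain C where "\<And>x. norm (g x) \<le> C"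
    using test_function_bounds(3)[OF g] by blast
  then show ?thesis
    using ft_integrable[OF g, of 0] test_function_bounds(2)[OF g]
    by (intro fourier_inversion[where C=C])
      (auto intro!: continuous_intros test_function_bounds(1)[OF g])
qed

lemma ft_cnj: "cnj (ft g \<xi>) = (LINT x|lborel. cis (x \<bullet> \<xi>) * of_real (g x))"
  unfolding fourier_def by (simp flip: Bochner_Integration.integral_cnj add: cis_cnj)

text \<open>An arbitrary integrable \<open>h\<close> stands in for the second transform, so that one
  Fubini argument serves both the Parseval identity, with \<open>h = ft f\<close>, and the
  fractional Laplacians, where \<open>h\<close> carries the factor
  \<open>norm \<xi> ^ k\<close>.\<close>

lemma parseval_multiplier:
  fixes g :: "'a::euclidean_space \<Rightarrow> real" and h :: "'a \<Rightarrow> complex"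
  assumes g: "g \<in> test_functions UNIV" and h: "integrable lborel h"
  shows "(LINT x|lborel. of_real (g x) * inverse_fourier h x) =
    (LINT \<xi>|lborel. cnj (ft g \<xi>) * h \<xi>) / of_real ((2 * pi) ^ DIM('a))"
proof -
  have "(LINT x|lborel. of_real (g x) * (LINT \<xi>|lborel. cis (x \<bullet> \<xi>) * h \<xi>)) =
      (LINT \<xi>|lborel. h \<xi> * (LINT x|lborel. cis (x \<bullet> \<xi>) * of_real (g x)))"
    using test_function_bounds(2)[OF g] h by (rule Fubini_kernel)
      (auto simp: split_beta' intro!: borel_measurable_continuous_onI continuous_intros)
  then show ?thesis
    unfolding inverse_fourier_def ft_cnj
    by (simp add: mult.commute)
qed

text \<open>Transforms are bounded by L1 norms, so each product pairs an integrable factor with a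
  bounded one: \<open>g\<close> with \<open>inverse_fourier h\<close>, and \<open>h\<close> with
  \<open>ft g\<close>.\<close>

lemma multiplier_integrable:
  fixes g :: "'a::euclidean_space \<Rightarrow> real" and h :: "'a \<Rightarrow> complex"
  assumes g: "g \<in> test_functions UNIV" and h: "integrable lborel h"
  shows "integrable lborel (\<lambda>x. of_real (g x) * inverse_fourier h x)"
    and "integrable lborel (\<lambda>\<xi>. cnj (ft g \<xi>) * h \<xi>)"
proof -
  note [measurable] = test_function_measurable[OF g] borel_measurable_integrable[OF h, simplified]
  have [measurable]: "inverse_fourier h \<in> borel_measurable borel"
    unfolding inverse_fourier_def by measurable
  let ?C = "(LINT \<xi>|lborel. norm (h \<xi>)) / norm (complex_of_real ((2 * pi) ^ DIM('a)))"
  have bound: "norm (inverse_fourier h x) \<le> ?C" for x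
  proof -
    have "norm (LINT \<xi>|lborel. cis (x \<bullet> \<xi>) * h \<xi>) \<le> (LINT \<xi>|lborel. norm (h \<xi>))"
      by (rule order_trans[OF integral_norm_bound]) (simp add: norm_mult)
    then show ?thesis
      unfolding inverse_fourier_def norm_divide by (intro divide_right_mono) auto
  qed
  show "integrable lborel (\<lambda>x. of_real (g x) * inverse_fourier h x)"
  proof (rule Bochner_Integration.integrable_bound)
    show "integrable lborel (\<lambda>x. of_real (g x) * complex_of_real ?C)"
      using test_function_bounds(2)[OF g] by (rule integrable_mult_left)
    have "norm (of_real (g x) * inverse_fourier h x) \<le> norm (of_real (g x) * complex_of_real ?C)" for x
    proof -
      have "\<bar>g x\<bar> * norm (inverse_fourier h x) \<le> \<bar>g x\<bar> * \<bar>?C\<bar>"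
        using bound[of x] by (intro mult_left_mono) linarith+
      then show ?thesis
        by (simp only: norm_mult norm_of_real)
    qed
    then show "AE x in lborel. norm (of_real (g x) * inverse_fourier h x) \<le> norm (of_real (g x) * complex_of_real ?C)"
      by blast
  qed simp
  obtain C where C: "\<And>\<xi>. norm (ft g \<xi>) \<le> C"
    using test_function_bounds(4)[OF g] by blast
  show "integrable lborel (\<lambda>\<xi>. cnj (ft g \<xi>) * h \<xi>)"
  proof (rule Bochner_Integration.integrable_bound[OF integrable_mult_right[OF h, of "of_real C"]])
    show "AE \<xi> in lborel. norm (cnj (ft g \<xi>) * h \<xi>) \<le> norm (of_real C * h \<xi>)"
      using C by (auto simp: norm_mult intro!: AE_I2 mult_right_mono intro: order_trans[OF _ abs_ge_self])
    have [measurable]: "cnj \<in> borel_measurable borel"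
      by (intro borel_measurable_continuous_onI continuous_intros)
    show "(\<lambda>\<xi>. cnj (ft g \<xi>) * h \<xi>) \<in> borel_measurable lborel"
      by measurable
  qed
qed

lemma parseval:
  fixes f g :: "'a::euclidean_space \<Rightarrow> real"
  assumes g: "g \<in> test_functions UNIV" and f: "f \<in> test_functions UNIV"
  shows "integrable lborel (\<lambda>x. g x * f x)"
    and "integrable lborel (\<lambda>\<xi>. Re (cnj (ft g \<xi>) * ft f \<xi>))"
    and "(LINT x|lborel. g x * f x) =
      (LINT \<xi>|lborel. Re (cnj (ft g \<xi>) * ft f \<xi>)) / (2 * pi) ^ DIM('a)"
proof -
  have h: "integrable lborel (ft f)"
    using ft_integrable[OF f, of 0] by simp
  have "integrable lborel (\<lambda>x. complex_of_real (g x * f x))"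
    using multiplier_integrable(1)[OF g h] by (simp add: ft_inversion[OF f])
  then show "integrable lborel (\<lambda>x. g x * f x)"
    using integrable_Re by fastforce
  note i2 = multiplier_integrable(2)[OF g h]
  show "integrable lborel (\<lambda>\<xi>. Re (cnj (ft g \<xi>) * ft f \<xi>))"
    using i2 by (rule integrable_Re)
  have "complex_of_real (LINT x|lborel. g x * f x) = (LINT x|lborel. of_real (g x) * inverse_fourier (ft f) x)"
    by (simp add: ft_inversion[OF f] flip: integral_complex_of_real)
  also have "\<dots> = (LINT \<xi>|lborel. cnj (ft g \<xi>) * ft f \<xi>) / of_real ((2 * pi) ^ DIM('a))"
    by (rule parseval_multiplier[OF g h])
  finally have "Re (complex_of_real (LINT x|lborel. g x * f x)) =
      Re ((LINT \<xi>|lborel. cnj (ft g \<xi>) * ft f \<xi>) / of_real ((2 * pi) ^ DIM('a)))"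
    by (rule arg_cong)
  then show "(LINT x|lborel. g x * f x) =
      (LINT \<xi>|lborel. Re (cnj (ft g \<xi>) * ft f \<xi>)) / (2 * pi) ^ DIM('a)"
    unfolding integral_Re[OF i2] by (simp only: Re_divide_of_real Re_complex_of_real)
qed

lemma frac_laplacian_pairing:
  fixes f :: "'a::euclidean_space \<Rightarrow> real"
  assumes f: "f \<in> test_functions UNIV" and k: "0 < k" "k \<le> 4" and \<gamma>: "2 * \<gamma> = real k"
  shows "integrable lborel (\<lambda>x. f x * frac_laplacian \<gamma> f x)"
    and "integrable lborel (\<lambda>\<xi>. norm \<xi> ^ k * (norm (ft f \<xi>))\<^sup>2)"
    and "(LINT x|lborel. f x * frac_laplacian \<gamma> f x) =
      (LINT \<xi>|lborel. norm \<xi> ^ k * (norm (ft f \<xi>))\<^sup>2) / (2 * pi) ^ DIM('a)"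
proof -
  let ?h = "\<lambda>\<xi>. of_real (norm \<xi> ^ k) * ft f \<xi>"
  have h: "integrable lborel ?h"
    using ft_integrable[OF f k(2)] .
  \<comment> \<open>At \<open>\<xi> = 0\<close> both sides are 0 because \<open>0 < k\<close>; for
    exponent 0 they would differ, since \<open>0 powr 0 = 0\<close> while
    \<open>0 ^ 0 = 1\<close>.\<close>
  have p: "norm \<xi> powr (2 * \<gamma>) = norm \<xi> ^ k" for \<xi> :: 'a
    unfolding \<gamma> using k(1) by (cases "norm \<xi> = 0") (auto simp: powr_realpow)
  have fl: "of_real (frac_laplacian \<gamma> f x) = inverse_fourier ?h x" for x
    unfolding of_real_frac_laplacian frac_laplacian_complex_def p ..
  have sq: "cnj (ft f \<xi>) * ?h \<xi> = of_real (norm \<xi> ^ k * (norm (ft f \<xi>))\<^sup>2)" for \<xi>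
    by (simp add: complex_norm_square mult_ac flip: of_real_power)
  have "integrable lborel (\<lambda>x. complex_of_real (f x * frac_laplacian \<gamma> f x))"
    using multiplier_integrable(1)[OF f h] by (simp add: fl)
  then show "integrable lborel (\<lambda>x. f x * frac_laplacian \<gamma> f x)"
    using integrable_Re by fastforce
  have "integrable lborel (\<lambda>\<xi>. complex_of_real (norm \<xi> ^ k * (norm (ft f \<xi>))\<^sup>2))"
    using multiplier_integrable(2)[OF f h] unfolding sq .
  then show "integrable lborel (\<lambda>\<xi>. norm \<xi> ^ k * (norm (ft f \<xi>))\<^sup>2)"
    using integrable_Re by fastforce
  have "complex_of_real (LINT x|lborel. f x * frac_laplacian \<gamma> f x) =
      (LINT x|lborel. of_real (f x) * inverse_fourier ?h x)"
    by (simp only: fl[symmetric] of_real_mult[symmetric] integral_complex_of_real)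
  also have "\<dots> = (LINT \<xi>|lborel. cnj (ft f \<xi>) * ?h \<xi>) / of_real ((2 * pi) ^ DIM('a))"
    by (rule parseval_multiplier[OF f h])
  also have "\<dots> = of_real ((LINT \<xi>|lborel. norm \<xi> ^ k * (norm (ft f \<xi>))\<^sup>2) / (2 * pi) ^ DIM('a))"
    unfolding sq integral_complex_of_real by simp
  finally show "(LINT x|lborel. f x * frac_laplacian \<gamma> f x) =
      (LINT \<xi>|lborel. norm \<xi> ^ k * (norm (ft f \<xi>))\<^sup>2) / (2 * pi) ^ DIM('a)"
    by (simp only: of_real_eq_iff)
qed

section \<open>Ordinary differential equations on the half line\<close>

lemma at_within_half_line_neq_bot: "0 \<le> y \<Longrightarrow> at y within {0..} \<noteq> (bot :: real filter)"
proof
  assume y: "0 \<le> y" and "at y within {0..} = bot"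
  then have "at_right y \<le> bot"
    using at_le[of "{y..}" "{0..}" y] by (simp add: at_within_Ici_at_right)
  then show False
    using trivial_limit_at_right_real[of y] by (metis le_bot)
qed

text \<open>Multiplied by the integrating factor \<open>exp (- r * y)\<close>, \<open>h\<close>
  becomes constant, and its zero at \<open>R\<close> determines the constant. The sign of
  \<open>r\<close> is free, and both signs occur later.\<close>

lemma first_order_decay:
  fixes h :: "real \<Rightarrow> complex"
  assumes d: "\<And>y. 0 \<le> y \<Longrightarrow> (h has_vector_derivative r *\<^sub>R h y) (at y within {0..})"
    and R: "0 \<le> R" "h R = 0" and y: "0 \<le> y"
  shows "h y = 0"
proof -
  let ?k = "\<lambda>y. exp (- r * y) *\<^sub>R h y"
  have "(?k has_vector_derivative 0) (at y within {0..})" if "y \<in> {0..}" for y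
  proof -
    have "((\<lambda>y. exp (- r * y)) has_real_derivative - r * exp (- r * y)) (at y within {0..})"
      by (auto intro!: derivative_eq_intros)
    from has_vector_derivative_scaleR[OF this d] that show ?thesis
      by (simp add: algebra_simps)
  qed
  then obtain c where c: "\<And>y. y \<in> {0..} \<Longrightarrow> ?k y = c"
    using has_vector_derivative_zero_constant[of "{0..}" ?k] by auto
  have "c = 0"
    using c[of R] R by simp
  then show ?thesis
    using c[of y] y by simp
qed

text \<open>The operator is \<open>(d/dy + r)\<^sup>2\<close>: the combination
  \<open>v1 + r v\<close> solves a first-order equation and vanishes, which is in turn a first-order
  equation for \<open>v\<close>.\<close>

lemma second_order_decay:
  fixes v v1 v2 :: "real \<Rightarrow> complex"
  assumes dv: "\<And>y. 0 \<le> y \<Longrightarrow> (v has_vector_derivative v1 y) (at y within {0..})"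
    and dv1: "\<And>y. 0 \<le> y \<Longrightarrow> (v1 has_vector_derivative v2 y) (at y within {0..})"
    and ode: "\<And>y. 0 \<le> y \<Longrightarrow> v2 y + (2 * r) *\<^sub>R v1 y + r\<^sup>2 *\<^sub>R v y = 0"
    and R: "0 \<le> R" "v R = 0" "v1 R = 0" and y: "0 \<le> y"
  shows "v y = 0"
proof -
  let ?w = "\<lambda>y. v1 y + r *\<^sub>R v y"
  have dw: "(?w has_vector_derivative (- r) *\<^sub>R ?w y) (at y within {0..})" if "0 \<le> y" for y
  proof -
    have "v2 y + r *\<^sub>R v1 y = (- r) *\<^sub>R ?w y"
      using ode[OF that] by (auto simp: complex_eq_iff algebra_simps power2_eq_square)
    then show ?thesis
      using has_vector_derivative_add[OF dv1[OF that] bounded_linear.has_vector_derivative[OF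
            bounded_linear_scaleR_right[of r] dv[OF that]]] by simp
  qed
  have w0: "?w y = 0" if "0 \<le> y" for y
    by (rule first_order_decay[OF dw R(1) _ that]) (use R in auto)
  have "v1 y = (- r) *\<^sub>R v y" if "0 \<le> y" for y
    using w0[OF that] by (simp add: eq_neg_iff_add_eq_0)
  then have "(v has_vector_derivative (- r) *\<^sub>R v y) (at y within {0..})" if "0 \<le> y" for y
    using dv[OF that] that by metis
  then show ?thesis
    using first_order_decay R y by blast
qed

lemma fourth_order_decay:
  fixes v v1 v2 v3 v4 :: "real \<Rightarrow> complex"
  assumes dv: "\<And>y. 0 \<le> y \<Longrightarrow> (v has_vector_derivative v1 y) (at y within {0..})"
    and dv1: "\<And>y. 0 \<le> y \<Longrightarrow> (v1 has_vector_derivative v2 y) (at y within {0..})"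
    and dv2: "\<And>y. 0 \<le> y \<Longrightarrow> (v2 has_vector_derivative v3 y) (at y within {0..})"
    and dv3: "\<And>y. 0 \<le> y \<Longrightarrow> (v3 has_vector_derivative v4 y) (at y within {0..})"
    and ode: "\<And>y. 0 \<le> y \<Longrightarrow> v4 y - (2 * r\<^sup>2) *\<^sub>R v2 y + r ^ 4 *\<^sub>R v y = 0"
    and R: "0 \<le> R" "v R = 0" "v1 R = 0" "v2 R = 0" "v3 R = 0" and y: "0 \<le> y"
  shows "v y = 0"
proof (rule second_order_decay[OF dv dv1 _ R(1-3) y, where r=r])
  fix y :: real assume "0 \<le> y"
  note lin = has_vector_derivative_add
    bounded_linear.has_vector_derivative[OF bounded_linear_scaleR_right]
  show "v2 y + (2 * r) *\<^sub>R v1 y + r\<^sup>2 *\<^sub>R v y = 0"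
  \<comment> \<open>The outer application left \<open>(d/dy + r)\<^sup>2 v = 0\<close> to show; this
    function is itself annihilated by \<open>(d/dy - r)\<^sup>2\<close>, so the same lemma applies
    with \<open>- r\<close>.\<close>
  proof (rule second_order_decay[where r="- r" and R=R and
        ?v1.0="\<lambda>y. v3 y + (2 * r) *\<^sub>R v2 y + r\<^sup>2 *\<^sub>R v1 y" and
        ?v2.0="\<lambda>y. v4 y + (2 * r) *\<^sub>R v3 y + r\<^sup>2 *\<^sub>R v2 y"])
    fix y :: real assume y: "0 \<le> y"
    show "((\<lambda>y. v2 y + (2 * r) *\<^sub>R v1 y + r\<^sup>2 *\<^sub>R v y) has_vector_derivative
        v3 y + (2 * r) *\<^sub>R v2 y + r\<^sup>2 *\<^sub>R v1 y) (at y within {0..})"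
      by (intro lin dv dv1 dv2 y)
    show "((\<lambda>y. v3 y + (2 * r) *\<^sub>R v2 y + r\<^sup>2 *\<^sub>R v1 y) has_vector_derivative
        v4 y + (2 * r) *\<^sub>R v3 y + r\<^sup>2 *\<^sub>R v2 y) (at y within {0..})"
      by (intro lin dv1 dv2 dv3 y)
    show "(v4 y + (2 * r) *\<^sub>R v3 y + r\<^sup>2 *\<^sub>R v2 y) +
        (2 * - r) *\<^sub>R (v3 y + (2 * r) *\<^sub>R v2 y + r\<^sup>2 *\<^sub>R v1 y) +
        (- r)\<^sup>2 *\<^sub>R (v2 y + (2 * r) *\<^sub>R v1 y + r\<^sup>2 *\<^sub>R v y) = 0"
      using ode[OF y] by (simp add: complex_eq_iff) algebra
  qed (use R \<open>0 \<le> y\<close> in auto)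
qed

section \<open>Integrals over the half line\<close>

lemma half_line_integral:
  fixes q :: "real \<Rightarrow> real"
  assumes q: "continuous_on {0..} q" and R: "0 \<le> R" "\<And>y. R \<le> y \<Longrightarrow> q y = 0"
  shows "integrable lborel (\<lambda>y. indicator {0..} y * q y)"
    and "(LINT y|lborel. indicator {0..} y * q y) = integral {0..R} q"
proof -
  have eq: "indicator {0..} y * q y = indicator {0..R} y *\<^sub>R q y" for y
    using R by (auto simp: indicator_def)
  have i: "set_integrable lborel {0..R} q"
    by (intro borel_integrable_atLeastAtMost' continuous_on_subset[OF q]) auto
  then show "integrable lborel (\<lambda>y. indicator {0..} y * q y)"
    unfolding eq set_integrable_def .
  show "(LINT y|lborel. indicator {0..} y * q y) = integral {0..R} q"
    using set_borel_integral_eq_integral(2)[OF i] unfolding eq set_lebesgue_integral_def .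
qed

lemma half_line_zero:
  fixes q :: "real \<Rightarrow> real"
  assumes q: "continuous_on {0..} q" and R: "\<And>y. R \<le> y \<Longrightarrow> q y = 0" and nn: "\<And>y. 0 \<le> q y"
    and z: "(\<integral>\<^sup>+y. ennreal (indicator {0..} y * q y) \<partial>lborel) = 0" and y: "0 \<le> y"
  shows "q y = 0"
proof -
  \<comment> \<open>Large enough to cover the support and the point \<open>y\<close>, and positive
    so that the interval is nondegenerate, which the pointwise conclusion from a zero integral
    requires.\<close>
  define R' where "R' = max (max R y) 1"
  have R': "0 \<le> R'" "\<And>y. R' \<le> y \<Longrightarrow> q y = 0" "y \<le> R'" "0 < R'"
    using R by (auto simp: R'_def)
  have "0 \<le> (LINT y|lborel. indicator {0..} y * q y)"
    by (intro integral_nonneg_AE AE_I2 mult_nonneg_nonneg nn) simp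
  moreover have "ennreal (LINT y|lborel. indicator {0..} y * q y) = 0"
    using z nn_integral_eq_integral[OF half_line_integral(1)[OF q R'(1,2)]] nn by simp
  ultimately have "(LINT y|lborel. indicator {0..} y * q y) = 0"
    by (simp add: ennreal_eq_0_iff)
  then have "integral {0..R'} q = 0"
    by (simp only: half_line_integral(2)[OF q R'(1,2)])
  then have "\<forall>x\<in>{0..R'}. q x = 0"
    using R'(4) by (subst (asm) integral_eq_0_iff) (auto intro!: continuous_on_subset[OF q] nn)
  then show ?thesis
    using y R'(3) by auto
qed

text \<open>For \<open>r > 0\<close> this is the energy of the decaying solution
  \<open>(a + (b + r a) y) exp (- r y)\<close>, which has value \<open>a\<close> and slope
  \<open>b\<close> at \<open>y = 0\<close>.\<close>

definition boundary_form :: "real \<Rightarrow> complex \<Rightarrow> complex \<Rightarrow> real" where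
  "boundary_form r a b = 2 * r ^ 3 * (norm a)\<^sup>2 + 2 * r\<^sup>2 * (b \<bullet> a) + 2 * r * (norm b)\<^sup>2"

text \<open>Lets the boundary term enter nonnegative integrals through \<open>ennreal\<close>
  without being truncated to 0.\<close>

lemma boundary_form_nonneg:
  assumes "0 \<le> r"
  shows "0 \<le> boundary_form r a b"
proof -
  have "boundary_form r a b = r ^ 3 * (norm a)\<^sup>2 + r * (norm b)\<^sup>2 + r * (norm (r *\<^sub>R a + b))\<^sup>2"
    unfolding boundary_form_def power2_norm_eq_inner
    by (simp add: inner_add_left inner_add_right inner_commute[of a b] power2_eq_square power3_eq_cube algebra_simps)
  then show ?thesis
    using assms by simp
qed

text \<open>Completing the square: along \<open>a = v, b = v', c = v''\<close> the difference of \<open>deficit\<close> and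
  \<open>energy\<close> is the \<open>y\<close>-derivative of \<open>boundary_form\<close>. The null equation of \<open>deficit\<close> is
  \<open>(d/dy + r)\<^sup>2 v = 0\<close>.\<close>

definition energy :: "real \<Rightarrow> complex \<Rightarrow> complex \<Rightarrow> complex \<Rightarrow> real" where
  "energy r a b c = r ^ 4 * (norm a)\<^sup>2 + 2 * r\<^sup>2 * (norm b)\<^sup>2 + (norm c)\<^sup>2"

lemma energy_nonneg: "0 \<le> energy r a b c"
  by (simp add: energy_def)

definition deficit :: "real \<Rightarrow> complex \<Rightarrow> complex \<Rightarrow> complex \<Rightarrow> real" where
  "deficit r a b c = (norm (c + (2 * r) *\<^sub>R b + r\<^sup>2 *\<^sub>R a))\<^sup>2"

lemma deficit_nonneg: "0 \<le> deficit r a b c"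
  by (simp add: deficit_def)

text \<open>The fundamental theorem of calculus for \<open>boundary_form\<close> along the solution
  curve: the upper end vanishes by the support condition, the lower end leaves the value at 0.
  Nonnegative integrals are used so that the result can be integrated over \<open>\<xi>\<close> by
  Tonelli.\<close>

lemma energy_identity:
  fixes v v1 v2 :: "real \<Rightarrow> complex"
  assumes dv: "\<And>y. 0 \<le> y \<Longrightarrow> (v has_vector_derivative v1 y) (at y within {0..})"
    and dv1: "\<And>y. 0 \<le> y \<Longrightarrow> (v1 has_vector_derivative v2 y) (at y within {0..})"
    and c2: "continuous_on {0..} v2"
    and R: "\<And>y. R \<le> y \<Longrightarrow> v y = 0 \<and> v1 y = 0 \<and> v2 y = 0" "0 \<le> R" and r: "0 \<le> r"
  shows "(\<integral>\<^sup>+y. ennreal (indicator {0..} y * energy r (v y) (v1 y) (v2 y)) \<partial>lborel) =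
    (\<integral>\<^sup>+y. ennreal (indicator {0..} y * deficit r (v y) (v1 y) (v2 y)) \<partial>lborel) +
    ennreal (boundary_form r (v 0) (v1 0))"
proof -
  let ?E = "\<lambda>y. energy r (v y) (v1 y) (v2 y)" and ?Q = "\<lambda>y. deficit r (v y) (v1 y) (v2 y)"
  let ?P = "\<lambda>y. boundary_form r (v y) (v1 y)"
  have c: "continuous_on {0..} v" "continuous_on {0..} v1"
    using dv dv1 by (auto intro!: continuous_on_vector_derivative)
  have cE: "continuous_on {0..} ?E" and cQ: "continuous_on {0..} ?Q"
    unfolding energy_def deficit_def by (intro continuous_intros c c2)+
  have RE: "\<And>y. R \<le> y \<Longrightarrow> ?E y = 0" and RQ: "\<And>y. R \<le> y \<Longrightarrow> ?Q y = 0"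
    using R by (simp_all add: energy_def deficit_def)
  note E = half_line_integral[OF cE R(2) RE] and Q = half_line_integral[OF cQ R(2) RQ]
  have dP: "(?P has_vector_derivative (?Q y - ?E y)) (at y within {0..R})" if "0 \<le> y" for y
  proof -
    have d: "(v has_derivative (\<lambda>h. h *\<^sub>R v1 y)) (at y within {0..R})"
        "(v1 has_derivative (\<lambda>h. h *\<^sub>R v2 y)) (at y within {0..R})"
      using dv[OF that] dv1[OF that] unfolding has_vector_derivative_def
      by (auto intro: has_derivative_subset)
    show ?thesis
      unfolding has_vector_derivative_def boundary_form_def energy_def deficit_def power2_norm_eq_inner
      by (rule derivative_eq_intros d refl)+
        (simp add: fun_eq_iff inner_add_left inner_add_right inner_commute algebra_simps
          power2_eq_square power3_eq_cube power4_eq_xxxx)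
  qed
  have "((\<lambda>y. ?Q y - ?E y) has_integral (?P R - ?P 0)) {0..R}"
    using R(2) dP by (intro fundamental_theorem_of_calculus) auto
  moreover have "?P R = 0"
    using R by (simp add: boundary_form_def)
  moreover have "integral {0..R} (\<lambda>y. ?Q y - ?E y) = integral {0..R} ?Q - integral {0..R} ?E"
    by (intro integral_diff integrable_continuous_interval continuous_on_subset[OF cQ]
        continuous_on_subset[OF cE]) auto
  ultimately have "integral {0..R} ?E = integral {0..R} ?Q + ?P 0"
    by (auto dest: integral_unique)
  then have eq: "(LINT y|lborel. indicator {0..} y * ?E y) = (LINT y|lborel. indicator {0..} y * ?Q y) + ?P 0"
    by (simp add: E(2) Q(2))
  have nnQ: "0 \<le> (LINT y|lborel. indicator {0..} y * ?Q y)"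
    by (intro integral_nonneg_AE AE_I2) (simp add: deficit_def)
  have "(\<integral>\<^sup>+y. ennreal (indicator {0..} y * ?E y) \<partial>lborel) = ennreal (LINT y|lborel. indicator {0..} y * ?E y)"
    by (intro nn_integral_eq_integral E(1) AE_I2 mult_nonneg_nonneg energy_nonneg indicator_pos_le)
  also have "\<dots> = ennreal (LINT y|lborel. indicator {0..} y * ?Q y) + ennreal (?P 0)"
    unfolding eq by (intro ennreal_plus nnQ boundary_form_nonneg r)
  also have "ennreal (LINT y|lborel. indicator {0..} y * ?Q y) = (\<integral>\<^sup>+y. ennreal (indicator {0..} y * ?Q y) \<partial>lborel)"
    by (intro nn_integral_eq_integral[symmetric] Q(1) AE_I2
        mult_nonneg_nonneg deficit_nonneg indicator_pos_le)
  finally show ?thesis .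
qed

section \<open>Partial Fourier transform on the half space\<close>

lemma ample_half_space: "ample (half_space :: ((real^'n) \<times> real) set)"
proof -
  have "closed (half_space :: ((real^'n) \<times> real) set)"
    unfolding half_space_def by (intro closed_Collect_le continuous_intros)
  moreover have "\<exists>d. 0 < \<bar>d\<bar> \<and> \<bar>d\<bar> < e \<and> x + d *\<^sub>R i \<in> half_space"
    if "x \<in> half_space" "i \<in> Basis" "0 < e" for x i :: "(real^'n) \<times> real" and e
    using that by (intro exI[of _ "e / 2"]) (auto simp: half_space_def Basis_prod_def)
  ultimately show ?thesis
    unfolding ample_def by blast
qed

text \<open>A horizontal slice stays in the half space, so the chain rule along
  \<open>x \<mapsto> (x, y)\<close> turns a derivative within the half space into an unrestricted
  one, also at \<open>y = 0\<close>.\<close>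

lemma slice_has_derivative:
  fixes g :: "(real^'n) \<times> real \<Rightarrow> real"
  assumes g: "g differentiable (at (x, y) within half_space)" and y: "0 \<le> y"
  shows "(\<lambda>x. g (x, y)) differentiable (at x)"
    and "dderiv UNIV b (\<lambda>x. g (x, y)) x = dderiv half_space (b, 0) g (x, y)"
proof -
  let ?D = "frechet_derivative g (at (x, y) within half_space)"
  have D: "(g has_derivative ?D) (at (x, y) within half_space)"
    using g by (simp add: frechet_derivative_works)
  have *: "((\<lambda>x. g (x, y)) has_derivative (\<lambda>h. ?D (h, 0))) (at x)"
  proof (rule has_derivative_in_compose[where f="\<lambda>x. (x, y)" and f'="\<lambda>h. (h, 0)" and g=g and g'="?D"])
    show "((\<lambda>x. (x, y)) has_derivative (\<lambda>h. (h, 0))) (at x)"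
      by (auto intro!: derivative_eq_intros)
    show "(g has_derivative ?D) (at (x, y) within range (\<lambda>x. (x, y)))"
      using y by (intro has_derivative_subset[OF D]) (auto simp: half_space_def)
  qed
  then show "(\<lambda>x. g (x, y)) differentiable (at x)"
    by (rule differentiableI)
  show "dderiv UNIV b (\<lambda>x. g (x, y)) x = dderiv half_space (b, 0) g (x, y)"
    using dderiv_eqI[OF ample_UNIV UNIV_I *] by (simp add: dderiv_def)
qed

lemma Basis_slice: "b \<in> Basis \<Longrightarrow> (b, 0) \<in> (Basis :: ((real^'n) \<times> real) set)"
  and Basis_normal: "(0, 1) \<in> (Basis :: ((real^'n) \<times> real) set)"
  by (auto simp: Basis_prod_def)

lemma slice_foldr:
  fixes g :: "(real^'n) \<times> real \<Rightarrow> real"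
  assumes g: "smooth_on half_space g" and y: "0 \<le> y" and bs: "set bs \<subseteq> Basis"
  shows "foldr (dderiv UNIV) bs (\<lambda>x. g (x, y)) =
    (\<lambda>x. foldr (dderiv half_space) (map (\<lambda>b. (b, 0)) bs) g (x, y))"
    and "foldr (dderiv half_space) (map (\<lambda>b. (b, 0)) bs) g differentiable (at (x, y) within half_space)"
proof -
  have diff: "foldr (dderiv half_space) (map (\<lambda>b. (b, 0)) cs) g differentiable (at (x, y) within half_space)"
    if "set cs \<subseteq> Basis" for x and cs :: "(real^'n) list"
  proof -
    have "set (map (\<lambda>b. (b, 0)) cs) \<subseteq> (Basis :: ((real^'n) \<times> real) set)"
      using that Basis_slice by auto
    then show ?thesis
      using g y unfolding smooth_on_def differentiable_on_def half_space_def by auto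
  qed
  then show "foldr (dderiv half_space) (map (\<lambda>b. (b, 0)) bs) g differentiable (at (x, y) within half_space)"
    using bs by blast
  show "foldr (dderiv UNIV) bs (\<lambda>x. g (x, y)) =
    (\<lambda>x. foldr (dderiv half_space) (map (\<lambda>b. (b, 0)) bs) g (x, y))"
    using bs
  proof (induction bs)
    case (Cons b bs)
    then have "set bs \<subseteq> Basis" by simp
    from slice_has_derivative(2)[OF diff[OF this] y] Cons show ?case
      by auto
  qed simp
qed

lemma slice_test_function:
  fixes g :: "(real^'n) \<times> real \<Rightarrow> real"
  assumes g: "g \<in> test_functions half_space" and y: "0 \<le> y"
  shows "(\<lambda>x. g (x, y)) \<in> test_functions UNIV"
proof -
  note s = test_functions_smooth[OF g]
  obtain R where R: "\<And>p. p \<in> half_space \<Longrightarrow> R \<le> norm p \<Longrightarrow> g p = 0"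
    using test_functions_support[OF g] by auto
  show ?thesis
  proof (rule test_functionsI[where R=R])
    show "smooth_on UNIV (\<lambda>x. g (x, y))"
      unfolding smooth_on_def differentiable_on_def
    proof (intro allI impI ballI)
      fix bs and x :: "real^'n" assume bs: "set bs \<subseteq> (Basis :: (real^'n) set)"
      show "foldr (dderiv UNIV) bs (\<lambda>x. g (x, y)) differentiable (at x)"
        unfolding slice_foldr(1)[OF s y bs]
        by (rule slice_has_derivative(1)[OF slice_foldr(2)[OF s y bs] y])
    qed
    show "g (x, y) = 0" if "R \<le> norm x" for x
      using that y by (intro R) (auto simp: half_space_def intro: order_trans[OF _ norm_fst_le])
  qed simp
qed

text \<open>Curried with \<open>\<xi>\<close> first, so that \<open>ftx g \<xi>\<close> is a curve
  in \<open>y\<close> to which the lemmas on differential equations apply.\<close>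

definition ftx :: "((real^'n) \<times> real \<Rightarrow> real) \<Rightarrow> real^'n \<Rightarrow> real \<Rightarrow> complex" where
  "ftx g \<xi> y = ft (\<lambda>x. g (x, y)) \<xi>"

lemma ftx_dderiv_x:
  assumes g: "g \<in> test_functions half_space" and b: "b \<in> Basis" and y: "0 \<le> y"
  shows "ftx (dderiv half_space (b, 0) g) \<xi> y = \<i> * of_real (\<xi> \<bullet> b) * ftx g \<xi> y"
proof -
  have "g differentiable (at (x, y) within half_space)" for x
    using test_functions_smooth[OF g] y by (intro smooth_on_differentiable) (auto simp: half_space_def)
  then show ?thesis
    unfolding ftx_def using ft_dderiv[OF slice_test_function[OF g y] b, of \<xi>]
    by (simp add: slice_has_derivative(2)[OF _ y])
qed

lemma ftx_support:
  fixes g :: "(real^'n) \<times> real \<Rightarrow> real"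
  assumes g: "g \<in> test_functions half_space"
  shows "\<exists>R\<ge>0. \<forall>y\<ge>R. \<forall>\<xi>. ftx g \<xi> y = 0"
proof -
  obtain R where R: "\<And>p. p \<in> half_space \<Longrightarrow> R \<le> norm p \<Longrightarrow> g p = 0"
    using test_functions_support[OF g] by auto
  have "ftx g \<xi> y = 0" if "max R 0 \<le> y" for y \<xi>
  proof -
    have "g (x, y) = 0" for x
      using that norm_snd_le[of y x] by (intro R) (auto simp: half_space_def)
    then show ?thesis
      by (simp add: ftx_def fourier_def)
  qed
  then show ?thesis
    by (intro exI[of _ "max R 0"]) auto
qed

text \<open>Differentiation under the integral sign with the closed half line as parameter set; at
  \<open>y = 0\<close> both the hypothesis on \<open>g\<close> and the result are one-sided.\<close>

lemma ftx_dderiv_y: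
  fixes g :: "(real^'n) \<times> real \<Rightarrow> real"
  assumes g: "g \<in> test_functions half_space" and y: "0 \<le> y"
  shows "(ftx g \<xi> has_vector_derivative ftx (dderiv half_space (0, 1) g) \<xi> y) (at y within {0..})"
proof -
  let ?d = "dderiv half_space (0, 1) g"
  have d: "?d \<in> test_functions half_space"
    using g by (intro test_functions_dderiv ample_half_space Basis_normal)
  obtain R where R: "\<And>p. p \<in> half_space \<Longrightarrow> R \<le> norm p \<Longrightarrow> g p = 0"
    using test_functions_support[OF g] by auto
  obtain R' where R': "\<And>p. p \<in> half_space \<Longrightarrow> R' \<le> norm p \<Longrightarrow> ?d p = 0"
    using test_functions_support[OF d] by auto
  obtain a where a: "cball 0 (max R R') \<subseteq> cbox (- a) (a :: real^'n)"
    using bounded_subset_cbox_symmetric[OF bounded_cball] by blast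
  have "((\<lambda>t. LINT x|lborel. cis (- (x \<bullet> \<xi>)) * complex_of_real (g (x, t))) has_vector_derivative
      (LINT x|lborel. cis (- (x \<bullet> \<xi>)) * complex_of_real (?d (x, y)))) (at y within {0..})"
  proof (rule leibniz_lborel[where a="- a" and b=a])
    fix t :: real and x :: "real^'n" assume t: "t \<in> {0..}"
    have "((\<lambda>s. g ((x, 0) + s *\<^sub>R (0, 1))) has_vector_derivative ?d ((x, 0) + t *\<^sub>R (0, 1))) (at t within {0..})"
      using t by (intro dderiv_path smooth_on_differentiable test_functions_smooth[OF g])
        (auto simp: half_space_def)
    then show "((\<lambda>t. cis (- (x \<bullet> \<xi>)) * complex_of_real (g (x, t))) has_vector_derivative
        cis (- (x \<bullet> \<xi>)) * complex_of_real (?d (x, t))) (at t within {0..})"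
      by (intro has_vector_derivative_mult_right has_vector_derivative_of_real)
        (simp add: has_real_derivative_iff_has_vector_derivative)
    show "cis (- (x \<bullet> \<xi>)) * complex_of_real (g (x, t)) = 0 \<and>
        cis (- (x \<bullet> \<xi>)) * complex_of_real (?d (x, t)) = 0" if "x \<notin> cbox (- a) a"
    proof -
      have "max R R' < norm x"
        using a that by (meson in_mono linorder_not_less mem_cball_0)
      then show ?thesis
        using R[of "(x, t)"] R'[of "(x, t)"] t norm_fst_le[of x t] by (auto simp: half_space_def)
    qed
  next
    fix t :: real assume "t \<in> {0..}"
    then show "continuous_on UNIV (\<lambda>x. cis (- (x \<bullet> \<xi>)) * complex_of_real (g (x, t)))"
      by (intro continuous_intros test_function_bounds(1) slice_test_function g) auto
  next
    show "continuous_on ({0..} \<times> UNIV) (\<lambda>(t, x). cis (- (x \<bullet> \<xi>)) * complex_of_real (?d (x, t)))"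
      unfolding split_beta'
      by (intro continuous_intros continuous_on_compose2[OF smooth_on_continuous[OF test_functions_smooth[OF d]]])
        (auto simp: half_space_def)
  qed (use y in auto)
  then show ?thesis
    by (simp add: ftx_def[abs_def] fourier_def)
qed

text \<open>A multiplier independent of \<open>y\<close> commutes with \<open>d/dy\<close>, by
  uniqueness of derivatives on the half line. This takes the place of symmetry of mixed partial
  derivatives.\<close>

lemma ftx_dderiv_y_scale:
  assumes g: "g \<in> test_functions half_space" and h: "h \<in> test_functions half_space"
    and eq: "\<And>y. 0 \<le> y \<Longrightarrow> ftx h \<xi> y = z * ftx g \<xi> y" and y: "0 \<le> y"
  shows "ftx (dderiv half_space (0, 1) h) \<xi> y = z * ftx (dderiv half_space (0, 1) g) \<xi> y"
proof (rule vector_derivative_unique_within[OF at_within_half_line_neq_bot[OF y] ftx_dderiv_y[OF h y]])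
  have "((\<lambda>y. z * ftx g \<xi> y) has_vector_derivative z * ftx (dderiv half_space (0, 1) g) \<xi> y) (at y within {0..})"
    by (intro has_vector_derivative_mult_right ftx_dderiv_y g y)
  then show "(ftx h \<xi> has_vector_derivative z * ftx (dderiv half_space (0, 1) g) \<xi> y) (at y within {0..})"
    by (rule has_vector_derivative_transform[rotated 2]) (use y eq in auto)
qed

lemma ftx_continuous:
  assumes "g \<in> test_functions half_space"
  shows "continuous_on {0..} (ftx g \<xi>)"
proof (rule continuous_on_vector_derivative)
  show "(ftx g \<xi> has_vector_derivative ftx (dderiv half_space (0, 1) g) \<xi> y) (at y within {0..})"
    if "y \<in> {0..}" for y
    using assms that by (intro ftx_dderiv_y) auto
qed

text \<open>Tonelli in \<open>\<xi>\<close> and \<open>y\<close> asks for joint measurability. The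
  indicator discards \<open>y < 0\<close>, where the values of \<open>g\<close> are
  arbitrary.\<close>

lemma ftx_measurable:
  fixes g :: "(real^'n) \<times> real \<Rightarrow> real"
  assumes g: "g \<in> test_functions half_space"
  shows "(\<lambda>p. indicator {0..} (snd p) *\<^sub>R ftx g (fst p) (snd p)) \<in> borel_measurable (lborel \<Otimes>\<^sub>M lborel)"
proof -
  have "half_space \<in> sets (borel :: ((real^'n) \<times> real) measure)"
    using ample_half_space unfolding ample_def by (intro borel_closed) auto
  then have "(\<lambda>p. indicator half_space p *\<^sub>R g p) \<in> borel_measurable borel"
    by (intro borel_measurable_continuous_on_indicator smooth_on_continuous test_functions_smooth g)
  then have [measurable]: "(\<lambda>p. indicator half_space p *\<^sub>R g p) \<in> borel_measurable (borel \<Otimes>\<^sub>M borel)"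
    by (simp add: borel_prod)
  have [measurable]: "(\<lambda>q. indicator half_space (snd q, snd (fst q)) *\<^sub>R g (snd q, snd (fst q)))
      \<in> borel_measurable ((lborel \<Otimes>\<^sub>M lborel) \<Otimes>\<^sub>M (lborel :: (real^'n) measure))"
    by (rule measurable_compose[of "\<lambda>q. (snd q, snd (fst q))" _ "borel \<Otimes>\<^sub>M borel"]) measurable
  have "indicator {0..} (snd p) *\<^sub>R ftx g (fst p) (snd p) =
     (LINT x|lborel. cis (- (x \<bullet> fst p)) *
        complex_of_real (indicator half_space (x, snd p) *\<^sub>R g (x, snd p)))" for p
    by (cases "0 \<le> snd p") (auto simp: ftx_def fourier_def half_space_def)
  moreover have "(\<lambda>p. LINT x|lborel. cis (- (x \<bullet> fst p)) *
        complex_of_real (indicator half_space (x, snd p) *\<^sub>R g (x, snd p)))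
      \<in> borel_measurable ((lborel :: (real^'n) measure) \<Otimes>\<^sub>M lborel)"
    by measurable
  ultimately show ?thesis
    by simp
qed

section \<open>The energy identity\<close>

lemma sum_inner_Basis_sq: "(\<Sum>b\<in>Basis. (\<xi> \<bullet> b)\<^sup>2) = (norm (\<xi> :: 'a::euclidean_space))\<^sup>2"
  unfolding power2_norm_eq_inner by (subst (2) euclidean_inner) (simp add: power2_eq_square)

lemma sum_Basis_slice:
  "(\<Sum>B\<in>(Basis :: ((real^'n) \<times> real) set). F B) = (\<Sum>b\<in>Basis. F (b, 0)) + F (0, 1)"
proof -
  have B: "(Basis :: ((real^'n) \<times> real) set) = (\<lambda>b. (b, 0)) ` Basis \<union> {(0, 1)}"
    by (auto simp: Basis_prod_def)
  show ?thesis
    unfolding B by (subst sum.union_disjoint) (auto simp: sum.reindex inj_on_def)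
qed

lemma grad_inner: "grad f x \<bullet> grad g x = (\<Sum>b\<in>Basis. dderiv UNIV b f x * dderiv UNIV b g x)"
  unfolding grad_def by (subst euclidean_inner) simp

text \<open>In the application \<open>\<psi>\<close> is minus the normal derivative, so
  \<open>- ft \<psi>\<close> plays the role of the slope in \<open>boundary_form\<close>; this sign
  turns the gradient term into its cross term. The factors
  \<open>(\<xi> \<bullet> b)\<^sup>2\<close> from the gradients add up to
  \<open>(norm \<xi>)\<^sup>2\<close>.\<close>

lemma boundary_integral:
  fixes f \<psi> :: "'a::euclidean_space \<Rightarrow> real"
  assumes f: "f \<in> test_functions UNIV" and \<psi>: "\<psi> \<in> test_functions UNIV"
  shows "integrable lborel (\<lambda>\<xi>. boundary_form (norm \<xi>) (ft f \<xi>) (- ft \<psi> \<xi>))"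
    and "2 * (LINT x|lborel. f x * frac_laplacian (3/2) f x - grad f x \<bullet> grad \<psi> x +
        \<psi> x * frac_laplacian (1/2) \<psi> x) =
      (LINT \<xi>|lborel. boundary_form (norm \<xi>) (ft f \<xi>) (- ft \<psi> \<xi>)) / (2 * pi) ^ DIM('a)"
proof -
  note F = frac_laplacian_pairing[of f 3 "3/2", OF f, simplified]
  note P = frac_laplacian_pairing[of \<psi> 1 "1/2", OF \<psi>, simplified]
  have d: "dderiv UNIV b f \<in> test_functions UNIV" "dderiv UNIV b \<psi> \<in> test_functions UNIV" if "b \<in> Basis" for b
    using that f \<psi> by (simp_all add: test_functions_dderiv ample_UNIV)
  have G1: "integrable lborel (\<lambda>x. grad f x \<bullet> grad \<psi> x)"
    unfolding grad_inner using parseval(1) d by (intro Bochner_Integration.integrable_sum) blast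
  have re: "Re (cnj (ft (dderiv UNIV b f) \<xi>) * ft (dderiv UNIV b \<psi>) \<xi>) = (\<xi> \<bullet> b)\<^sup>2 * (ft \<psi> \<xi> \<bullet> ft f \<xi>)"
    if "b \<in> Basis" for b \<xi>
    unfolding ft_dderiv[OF f that] ft_dderiv[OF \<psi> that]
    by (simp add: inner_complex_def power2_eq_square algebra_simps)
  have sumre: "(\<Sum>b\<in>Basis. Re (cnj (ft (dderiv UNIV b f) \<xi>) * ft (dderiv UNIV b \<psi>) \<xi>)) =
      (norm \<xi>)\<^sup>2 * (ft \<psi> \<xi> \<bullet> ft f \<xi>)" for \<xi>
    unfolding sum_inner_Basis_sq[symmetric] sum_distrib_right by (intro sum.cong refl re)
  have G2: "integrable lborel (\<lambda>\<xi>. (norm \<xi>)\<^sup>2 * (ft \<psi> \<xi> \<bullet> ft f \<xi>))"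
    unfolding sumre[symmetric] using parseval(2) d by (intro Bochner_Integration.integrable_sum) blast
  have "(LINT x|lborel. grad f x \<bullet> grad \<psi> x) =
      (\<Sum>b\<in>Basis. LINT x|lborel. dderiv UNIV b f x * dderiv UNIV b \<psi> x)"
    unfolding grad_inner using parseval(1) d by (intro Bochner_Integration.integral_sum) blast
  also have "\<dots> = (\<Sum>b\<in>Basis. (LINT \<xi>|lborel. Re (cnj (ft (dderiv UNIV b f) \<xi>) * ft (dderiv UNIV b \<psi>) \<xi>)) / (2 * pi) ^ DIM('a))"
    using parseval(3) d by (intro sum.cong refl) blast
  also have "\<dots> = (\<Sum>b\<in>Basis. LINT \<xi>|lborel. Re (cnj (ft (dderiv UNIV b f) \<xi>) * ft (dderiv UNIV b \<psi>) \<xi>)) / (2 * pi) ^ DIM('a)"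
    by (simp only: sum_divide_distrib)
  also have "(\<Sum>b\<in>Basis. LINT \<xi>|lborel. Re (cnj (ft (dderiv UNIV b f) \<xi>) * ft (dderiv UNIV b \<psi>) \<xi>)) =
      (LINT \<xi>|lborel. (norm \<xi>)\<^sup>2 * (ft \<psi> \<xi> \<bullet> ft f \<xi>))"
    unfolding sumre[symmetric] using parseval(2) d
    by (intro Bochner_Integration.integral_sum[symmetric]) blast
  finally have G3: "(LINT x|lborel. grad f x \<bullet> grad \<psi> x) =
      (LINT \<xi>|lborel. (norm \<xi>)\<^sup>2 * (ft \<psi> \<xi> \<bullet> ft f \<xi>)) / (2 * pi) ^ DIM('a)" .
  have B: "boundary_form (norm \<xi>) (ft f \<xi>) (- ft \<psi> \<xi>) = 2 * (norm \<xi> ^ 3 * (norm (ft f \<xi>))\<^sup>2 -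
      (norm \<xi>)\<^sup>2 * (ft \<psi> \<xi> \<bullet> ft f \<xi>) + norm \<xi> * (norm (ft \<psi> \<xi>))\<^sup>2)" for \<xi>
    by (simp add: boundary_form_def algebra_simps)
  show "integrable lborel (\<lambda>\<xi>. boundary_form (norm \<xi>) (ft f \<xi>) (- ft \<psi> \<xi>))"
    unfolding B by (intro integrable_mult_right Bochner_Integration.integrable_add Bochner_Integration.integrable_diff F(2) P(2) G2)
  have "(LINT x|lborel. f x * frac_laplacian (3/2) f x - grad f x \<bullet> grad \<psi> x +
        \<psi> x * frac_laplacian (1/2) \<psi> x) =
      (LINT x|lborel. f x * frac_laplacian (3/2) f x) - (LINT x|lborel. grad f x \<bullet> grad \<psi> x) +
      (LINT x|lborel. \<psi> x * frac_laplacian (1/2) \<psi> x)"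
    using F(1) P(1) G1 by simp
  moreover have "(LINT \<xi>|lborel. boundary_form (norm \<xi>) (ft f \<xi>) (- ft \<psi> \<xi>)) =
      2 * ((LINT \<xi>|lborel. norm \<xi> ^ 3 * (norm (ft f \<xi>))\<^sup>2) -
      (LINT \<xi>|lborel. (norm \<xi>)\<^sup>2 * (ft \<psi> \<xi> \<bullet> ft f \<xi>)) + (LINT \<xi>|lborel. norm \<xi> * (norm (ft \<psi> \<xi>))\<^sup>2))"
    unfolding B using F(2) P(2) G2 by simp
  ultimately show "2 * (LINT x|lborel. f x * frac_laplacian (3/2) f x - grad f x \<bullet> grad \<psi> x +
        \<psi> x * frac_laplacian (1/2) \<psi> x) =
      (LINT \<xi>|lborel. boundary_form (norm \<xi>) (ft f \<xi>) (- ft \<psi> \<xi>)) / (2 * pi) ^ DIM('a)"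
    by (simp add: F(3) P(3) G3 diff_divide_distrib add_divide_distrib)
qed

abbreviation (input) hderiv :: "(real^'n) \<times> real \<Rightarrow> ((real^'n) \<times> real \<Rightarrow> real) \<Rightarrow> (real^'n) \<times> real \<Rightarrow> real" where
  "hderiv \<equiv> dderiv half_space"

lemma hderiv_test: "g \<in> test_functions half_space \<Longrightarrow> b \<in> Basis \<Longrightarrow> hderiv b g \<in> test_functions half_space"
  by (intro test_functions_dderiv ample_half_space)

lemma hderiv_x_test: "g \<in> test_functions half_space \<Longrightarrow> b \<in> Basis \<Longrightarrow> hderiv (b, 0) g \<in> test_functions half_space"
  by (intro hderiv_test Basis_slice)

lemma hderiv_y_test: "g \<in> test_functions half_space \<Longrightarrow> hderiv (0, 1) g \<in> test_functions half_space"
  by (intro hderiv_test Basis_normal)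

lemma ftx_mixed:
  assumes g: "g \<in> test_functions half_space" and b: "b \<in> Basis" and y: "0 \<le> y"
  shows "ftx (hderiv (0, 1) (hderiv (b, 0) g)) \<xi> y = \<i> * of_real (\<xi> \<bullet> b) * ftx (hderiv (0, 1) g) \<xi> y"
  using g b y by (intro ftx_dderiv_y_scale hderiv_x_test ftx_dderiv_x)

lemma hderiv_zero:
  assumes "\<And>q. q \<in> half_space \<Longrightarrow> g q = 0" "p \<in> half_space"
  shows "hderiv b g p = 0"
  using assms by (intro dderiv_zero[where d=1] ample_half_space) auto

text \<open>Parseval is applied at fixed height to each second derivative separately. The
  coefficient 2 in \<open>energy\<close> arises because the Hessian norm counts every mixed
  derivative in both orders.\<close>

lemma hessian_slice:
  fixes u :: "(real^'n) \<times> real \<Rightarrow> real" and y :: real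
  defines "E \<equiv> \<lambda>\<xi>. energy (norm \<xi>) (ftx u \<xi> y) (ftx (hderiv (0, 1) u) \<xi> y)
      (ftx (hderiv (0, 1) (hderiv (0, 1) u)) \<xi> y)"
  assumes u: "u \<in> test_functions half_space" and y: "0 \<le> y"
  shows "integrable lborel (\<lambda>x. hessian_norm_sq half_space u (x, y))"
    and "integrable lborel E"
    and "(LINT x|lborel. hessian_norm_sq half_space u (x, y)) = (LINT \<xi>|lborel. E \<xi>) / (2 * pi) ^ DIM(real^'n)"
proof -
  let ?N = "\<lambda>B C \<xi>. (norm (ftx (hderiv B (hderiv C u)) \<xi> y))\<^sup>2"
  let ?K = "(2 * pi) ^ DIM(real^'n)"
  have P: "integrable lborel (\<lambda>x. (hderiv B (hderiv C u) (x, y))\<^sup>2)"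
    "integrable lborel (?N B C)"
    "(LINT x|lborel. (hderiv B (hderiv C u) (x, y))\<^sup>2) = (LINT \<xi>|lborel. ?N B C \<xi>) / ?K"
    if "B \<in> Basis" "C \<in> Basis" for B C
  proof -
    have t: "(\<lambda>x. hderiv B (hderiv C u) (x, y)) \<in> test_functions UNIV"
      using that by (intro slice_test_function hderiv_test u y)
    have re: "Re (cnj z * z) = (norm z)\<^sup>2" for z :: complex
      by (metis complex_norm_square Re_complex_of_real mult.commute of_real_power)
    from parseval[OF t t] show "integrable lborel (\<lambda>x. (hderiv B (hderiv C u) (x, y))\<^sup>2)"
      "integrable lborel (?N B C)"
      "(LINT x|lborel. (hderiv B (hderiv C u) (x, y))\<^sup>2) = (LINT \<xi>|lborel. ?N B C \<xi>) / ?K"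
      unfolding re ftx_def by (simp_all add: power2_eq_square)
  qed
  have E: "E \<xi> = (\<Sum>B\<in>Basis. \<Sum>C\<in>Basis. ?N B C \<xi>)" for \<xi>
  proof -
    have xx: "?N (b, 0) (c, 0) \<xi> = (\<xi> \<bullet> b)\<^sup>2 * ((\<xi> \<bullet> c)\<^sup>2 * (norm (ftx u \<xi> y))\<^sup>2)"
      if "b \<in> Basis" "c \<in> Basis" for b c
      using that y by (simp add: ftx_dderiv_x hderiv_x_test u norm_mult power_mult_distrib)
    have xy: "?N (b, 0) (0, 1) \<xi> = (\<xi> \<bullet> b)\<^sup>2 * (norm (ftx (hderiv (0, 1) u) \<xi> y))\<^sup>2"
      if "b \<in> Basis" for b
      using that y by (simp add: ftx_dderiv_x hderiv_y_test u norm_mult power_mult_distrib)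
    \<comment> \<open>Here the tangential derivative is taken first, so its factor has to be pulled
      through \<open>d/dy\<close>.\<close>
    have yx: "?N (0, 1) (b, 0) \<xi> = (\<xi> \<bullet> b)\<^sup>2 * (norm (ftx (hderiv (0, 1) u) \<xi> y))\<^sup>2"
      if "b \<in> Basis" for b
      using that y by (simp add: ftx_mixed u norm_mult power_mult_distrib)
    have "(\<Sum>B\<in>Basis. \<Sum>C\<in>Basis. ?N B C \<xi>) =
        (\<Sum>b\<in>Basis. (\<Sum>c\<in>Basis. ?N (b, 0) (c, 0) \<xi>) + ?N (b, 0) (0, 1) \<xi>) +
        ((\<Sum>c\<in>Basis. ?N (0, 1) (c, 0) \<xi>) + ?N (0, 1) (0, 1) \<xi>)"
      by (simp only: sum_Basis_slice)
    also have "\<dots> = (norm \<xi>)\<^sup>2 * ((norm \<xi>)\<^sup>2 * (norm (ftx u \<xi> y))\<^sup>2) +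
        (norm \<xi>)\<^sup>2 * (norm (ftx (hderiv (0, 1) u) \<xi> y))\<^sup>2 +
        ((norm \<xi>)\<^sup>2 * (norm (ftx (hderiv (0, 1) u) \<xi> y))\<^sup>2 + ?N (0, 1) (0, 1) \<xi>)"
      by (simp add: xx xy yx sum.distrib sum_inner_Basis_sq flip: sum_distrib_right sum_distrib_left)
    also have "\<dots> = E \<xi>"
      unfolding E_def energy_def by (simp add: power2_eq_square power4_eq_xxxx)
    finally show ?thesis ..
  qed
  show "integrable lborel (\<lambda>x. hessian_norm_sq half_space u (x, y))"
    unfolding hessian_norm_sq_def by (intro Bochner_Integration.integrable_sum P(1))
  show "integrable lborel E"
    unfolding E by (intro Bochner_Integration.integrable_sum P(2))
  have "(LINT x|lborel. hessian_norm_sq half_space u (x, y)) =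
      (\<Sum>B\<in>Basis. \<Sum>C\<in>Basis. (LINT \<xi>|lborel. ?N B C \<xi>) / ?K)"
    unfolding hessian_norm_sq_def by (simp add: Bochner_Integration.integral_sum P(1) P(3))
  also have "\<dots> = (\<Sum>B\<in>Basis. \<Sum>C\<in>Basis. LINT \<xi>|lborel. ?N B C \<xi>) / ?K"
    by (simp only: sum_divide_distrib)
  also have "(\<Sum>B\<in>Basis. \<Sum>C\<in>Basis. LINT \<xi>|lborel. ?N B C \<xi>) = (LINT \<xi>|lborel. E \<xi>)"
    unfolding E by (simp add: Bochner_Integration.integral_sum P(2))
  finally show "(LINT x|lborel. hessian_norm_sq half_space u (x, y)) = (LINT \<xi>|lborel. E \<xi>) / ?K" .
qed

section \<open>The bi-Laplacian on the Fourier side\<close>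

lemma bilaplacian_expand:
  assumes u: "u \<in> test_functions half_space" and p: "p \<in> half_space"
  shows "bilaplacian half_space u p =
    (\<Sum>B\<in>Basis. \<Sum>C\<in>Basis. hderiv B (hderiv B (hderiv C (hderiv C u))) p)"
proof -
  have diff: "g differentiable (at q within half_space)" if "g \<in> test_functions half_space" "q \<in> half_space"
    for g and q :: "(real^'a) \<times> real"
    using that by (intro smooth_on_differentiable test_functions_smooth)
  have lap: "laplacian half_space u = (\<lambda>q. \<Sum>C\<in>Basis. hderiv C (hderiv C u) q)"
    by (simp add: laplacian_def fun_eq_iff)
  have 1: "hderiv B (laplacian half_space u) q = (\<Sum>C\<in>Basis. hderiv B (hderiv C (hderiv C u)) q)"
    if "q \<in> half_space" for B q
    unfolding lap by (intro dderiv_sum ample_half_space that diff hderiv_test u)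
  have "hderiv B (hderiv B (laplacian half_space u)) p =
      (\<Sum>C\<in>Basis. hderiv B (hderiv B (hderiv C (hderiv C u))) p)" if B: "B \<in> Basis" for B
  proof -
    \<comment> \<open>The formula for the first derivative of the Laplacian is known on
      \<open>half_space\<close> only, which is all that a derivative within
      \<open>half_space\<close> sees.\<close>
    have "hderiv B (hderiv B (laplacian half_space u)) p =
        hderiv B (\<lambda>q. \<Sum>C\<in>Basis. hderiv B (hderiv C (hderiv C u)) q) p"
      using 1 by (intro dderiv_cong p)
    also have "\<dots> = (\<Sum>C\<in>Basis. hderiv B (hderiv B (hderiv C (hderiv C u))) p)"
      by (intro dderiv_sum ample_half_space p diff hderiv_test u B)
    finally show ?thesis .
  qed
  then show ?thesis
    unfolding bilaplacian_def laplacian_def[of _ "laplacian half_space u"] by simp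
qed

lemma ft_sum:
  fixes g :: "'i \<Rightarrow> 'a::euclidean_space \<Rightarrow> real"
  assumes "\<And>i. i \<in> A \<Longrightarrow> g i \<in> test_functions UNIV"
  shows "ft (\<lambda>x. \<Sum>i\<in>A. g i x) \<xi> = (\<Sum>i\<in>A. ft (g i) \<xi>)"
  unfolding fourier_def using ft_integrand_integrable[OF assms, of _ \<xi>]
  by (simp add: sum_distrib_left Bochner_Integration.integral_sum)

text \<open>Each tangential second derivative contributes
  \<open>- (\<xi> \<bullet> b)\<^sup>2\<close>, and these sum to \<open>- r\<^sup>2\<close> with
  \<open>r = norm \<xi>\<close>; the right-hand side is
  \<open>(d\<^sup>2/dy\<^sup>2 - r\<^sup>2)\<^sup>2 v\<close> expanded.\<close>

lemma ftx_bilaplacian: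
  assumes u: "u \<in> test_functions half_space" and y: "0 \<le> y"
  shows "ftx (bilaplacian half_space u) \<xi> y =
    ftx (hderiv (0, 1) (hderiv (0, 1) (hderiv (0, 1) (hderiv (0, 1) u)))) \<xi> y -
    (2 * (norm \<xi>)\<^sup>2) *\<^sub>R ftx (hderiv (0, 1) (hderiv (0, 1) u)) \<xi> y + norm \<xi> ^ 4 *\<^sub>R ftx u \<xi> y"
proof -
  let ?G = "\<lambda>B C. hderiv B (hderiv B (hderiv C (hderiv C u)))"
  let ?v = "ftx u \<xi> y" and ?v2 = "ftx (hderiv (0, 1) (hderiv (0, 1) u)) \<xi> y"
  have p: "(x, y) \<in> half_space" for x :: "real^'a"
    using y by (simp add: half_space_def)
  have i2: "\<i> * of_real a * (\<i> * of_real a * z) = - of_real (a\<^sup>2) * z" for a z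
    by (simp add: complex_eq_iff algebra_simps power2_eq_square)
  have dxx: "ftx (hderiv (b, 0) (hderiv (b, 0) g)) \<xi> y = - of_real ((\<xi> \<bullet> b)\<^sup>2) * ftx g \<xi> y"
    if "g \<in> test_functions half_space" "b \<in> Basis" "0 \<le> y" for g b y
    using that by (simp only: ftx_dderiv_x hderiv_x_test i2)
  have xx: "ftx (?G (b, 0) (c, 0)) \<xi> y = of_real ((\<xi> \<bullet> b)\<^sup>2) * (of_real ((\<xi> \<bullet> c)\<^sup>2) * ?v)"
    if "b \<in> Basis" "c \<in> Basis" for b c
    using that y by (simp add: dxx hderiv_x_test u)
  have xy: "ftx (?G (b, 0) (0, 1)) \<xi> y = - of_real ((\<xi> \<bullet> b)\<^sup>2) * ?v2" if "b \<in> Basis" for b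
    using that y by (simp only: dxx hderiv_y_test u)
  \<comment> \<open>The normal derivatives act outside the tangential ones, so the multiplier is
    carried through \<open>d/dy\<close> twice.\<close>
  have yx: "ftx (?G (0, 1) (c, 0)) \<xi> y = - of_real ((\<xi> \<bullet> c)\<^sup>2) * ?v2" if "c \<in> Basis" for c
    using that y by (intro ftx_dderiv_y_scale hderiv_x_test hderiv_y_test u dxx)
  have s: "(\<Sum>c\<in>Basis. of_real ((\<xi> \<bullet> c)\<^sup>2) * z) = of_real ((norm \<xi>)\<^sup>2) * z" for z :: complex
    by (simp only: sum_distrib_right[symmetric] of_real_sum[symmetric] sum_inner_Basis_sq)
  have "ftx (bilaplacian half_space u) \<xi> y = ft (\<lambda>x. \<Sum>B\<in>Basis. \<Sum>C\<in>Basis. ?G B C (x, y)) \<xi>"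
    unfolding ftx_def by (simp only: bilaplacian_expand[OF u p])
  also have "\<dots> = ft (\<lambda>x. \<Sum>D\<in>Basis \<times> Basis. ?G (fst D) (snd D) (x, y)) \<xi>"
    by (simp only: sum.cartesian_product split_beta')
  also have "\<dots> = (\<Sum>D\<in>Basis \<times> Basis. ft (\<lambda>x. ?G (fst D) (snd D) (x, y)) \<xi>)"
    by (intro ft_sum slice_test_function hderiv_test u y) auto
  also have "\<dots> = (\<Sum>B\<in>Basis. \<Sum>C\<in>Basis. ftx (?G B C) \<xi> y)"
    by (simp only: sum.cartesian_product split_beta' ftx_def)
  also have "\<dots> = (\<Sum>b\<in>Basis. (\<Sum>c\<in>Basis. ftx (?G (b, 0) (c, 0)) \<xi> y) + ftx (?G (b, 0) (0, 1)) \<xi> y) +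
      ((\<Sum>c\<in>Basis. ftx (?G (0, 1) (c, 0)) \<xi> y) + ftx (?G (0, 1) (0, 1)) \<xi> y)"
    by (simp only: sum_Basis_slice)
  also have "\<dots> = (\<Sum>b\<in>Basis. (\<Sum>c\<in>Basis. of_real ((\<xi> \<bullet> b)\<^sup>2) * (of_real ((\<xi> \<bullet> c)\<^sup>2) * ?v)) +
      of_real ((\<xi> \<bullet> b)\<^sup>2) * - ?v2) +
      ((\<Sum>c\<in>Basis. of_real ((\<xi> \<bullet> c)\<^sup>2) * - ?v2) + ftx (?G (0, 1) (0, 1)) \<xi> y)"
    by (intro arg_cong2[where f="(+)"] sum.cong refl) (simp_all add: xx xy yx)
  also have "\<dots> = of_real ((norm \<xi>)\<^sup>2) * (of_real ((norm \<xi>)\<^sup>2) * ?v) +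
      of_real ((norm \<xi>)\<^sup>2) * - ?v2 +
      (of_real ((norm \<xi>)\<^sup>2) * - ?v2 + ftx (?G (0, 1) (0, 1)) \<xi> y)"
    by (simp only: sum.distrib sum_distrib_left[symmetric] s)
  also have "\<dots> = ftx (?G (0, 1) (0, 1)) \<xi> y - (2 * (norm \<xi>)\<^sup>2) *\<^sub>R ?v2 + norm \<xi> ^ 4 *\<^sub>R ?v"
    by (simp add: scaleR_conv_of_real power2_eq_square power4_eq_xxxx algebra_simps)
  finally show ?thesis .
qed

text \<open>The inversion integral on a slice ignores a null set of \<open>\<xi>\<close>, yet
  recovers \<open>u\<close> at every point of the slice.\<close>

lemma ftx_zero_imp_zero:
  assumes u: "u \<in> test_functions half_space"
    and z: "AE \<xi> in lborel. \<forall>y\<ge>0. ftx u \<xi> y = 0" and p: "p \<in> half_space"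
  shows "u p = 0"
proof -
  obtain x y where xy: "p = (x, y)" "0 \<le> y"
    using p by (cases p) (auto simp: half_space_def)
  have "(LINT \<xi>|lborel. cis (x \<bullet> \<xi>) * ft (\<lambda>x. u (x, y)) \<xi>) = 0"
    using z xy(2) by (intro integral_eq_zero_AE) (auto simp: ftx_def elim: eventually_mono)
  then have "inverse_fourier (ft (\<lambda>x. u (x, y))) x = 0"
    by (simp add: inverse_fourier_def)
  then have "complex_of_real (u (x, y)) = 0"
    by (simp only: ft_inversion[OF slice_test_function[OF u xy(2)]])
  then show ?thesis
    using xy by simp
qed

lemma common_support:
  assumes "u \<in> test_functions half_space" "g \<in> test_functions half_space" "h \<in> test_functions half_space"
  shows "\<exists>R\<ge>0. \<forall>y\<ge>R. ftx u \<xi> y = 0 \<and> ftx g \<xi> y = 0 \<and> ftx h \<xi> y = 0"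
proof -
  obtain R1 R2 R3 where "0 \<le> R1" "\<forall>y\<ge>R1. ftx u \<xi> y = 0" "\<forall>y\<ge>R2. ftx g \<xi> y = 0" "\<forall>y\<ge>R3. ftx h \<xi> y = 0"
    using ftx_support[OF assms(1)] ftx_support[OF assms(2)] ftx_support[OF assms(3)] by blast
  then show ?thesis
    by (intro exI[of _ "max R1 (max R2 R3)"]) auto
qed

text \<open>For every \<open>\<xi>\<close>, including 0, the transform solves the fourth-order
  equation with \<open>r = norm \<xi>\<close> and vanishes together with three derivatives at a
  height above the support.\<close>

lemma bilaplacian_zero_iff:
  assumes u: "u \<in> test_functions half_space"
  shows "(\<forall>p\<in>half_space. bilaplacian half_space u p = 0) \<longleftrightarrow> (\<forall>p\<in>half_space. u p = 0)"
proof
  assume bi: "\<forall>p\<in>half_space. bilaplacian half_space u p = 0"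
  note t = hderiv_y_test[OF u] hderiv_y_test[OF hderiv_y_test[OF u]]
    hderiv_y_test[OF hderiv_y_test[OF hderiv_y_test[OF u]]]
  have "ftx u \<xi> y = 0" if "0 \<le> y" for \<xi> y
  proof -
    obtain R where R: "0 \<le> R" "\<forall>y\<ge>R. ftx u \<xi> y = 0 \<and> ftx (hderiv (0, 1) u) \<xi> y = 0 \<and>
        ftx (hderiv (0, 1) (hderiv (0, 1) u)) \<xi> y = 0"
      using common_support[OF u t(1,2)] by blast
    obtain R' where R': "0 \<le> R'" "\<forall>y\<ge>R'. ftx (hderiv (0, 1) (hderiv (0, 1) (hderiv (0, 1) u))) \<xi> y = 0"
      using ftx_support[OF t(3)] by blast
    show ?thesis
    proof (rule fourth_order_decay[OF ftx_dderiv_y[OF u] ftx_dderiv_y[OF t(1)] ftx_dderiv_y[OF t(2)]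
          ftx_dderiv_y[OF t(3)], where r="norm \<xi>" and R="max R R'"])
      fix y :: real assume y: "0 \<le> y"
      then have "bilaplacian half_space u (x, y) = 0" for x
        using bi by (simp add: half_space_def)
      then have "ftx (bilaplacian half_space u) \<xi> y = 0"
        by (simp add: ftx_def fourier_def)
      then show "ftx (hderiv (0, 1) (hderiv (0, 1) (hderiv (0, 1) (hderiv (0, 1) u)))) \<xi> y -
          (2 * (norm \<xi>)\<^sup>2) *\<^sub>R ftx (hderiv (0, 1) (hderiv (0, 1) u)) \<xi> y + norm \<xi> ^ 4 *\<^sub>R ftx u \<xi> y = 0"
        by (simp only: ftx_bilaplacian[OF u y])
    qed (use R R' that in auto)
  qed
  then show "\<forall>p\<in>half_space. u p = 0"
    using ftx_zero_imp_zero[OF u] by auto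
next
  assume "\<forall>p\<in>half_space. u p = 0"
  then have "hderiv B (hderiv B (hderiv C (hderiv C u))) p = 0" if "p \<in> half_space" for B C p
    using that by (intro hderiv_zero) auto
  then show "\<forall>p\<in>half_space. bilaplacian half_space u p = 0"
    by (simp add: bilaplacian_expand[OF u])
qed

text \<open>Excludes the default value 0 that the Bochner integral assigns to a function that is not
  integrable, and so permits the passage to a nonnegative integral.\<close>

lemma hessian_integrable:
  assumes u: "u \<in> test_functions half_space"
  shows "set_integrable lborel half_space (hessian_norm_sq half_space u)"
proof -
  let ?H = "hessian_norm_sq half_space u"
  have t: "hderiv B (hderiv C u) \<in> test_functions half_space" if "B \<in> Basis" "C \<in> Basis" for B C
    using that by (intro hderiv_test u)
  have c: "continuous_on half_space ?H"
    unfolding hessian_norm_sq_def[abs_def]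
    by (intro continuous_intros smooth_on_continuous test_functions_smooth t)
  obtain R where R: "\<And>p. p \<in> half_space \<Longrightarrow> R \<le> norm p \<Longrightarrow> u p = 0"
    using test_functions_support[OF u] by auto
  have z: "?H p = 0" if p: "p \<in> half_space" "R + 1 < norm p" for p
  proof -
    have 1: "hderiv C u q = 0" if "q \<in> half_space" "R < norm q" for C q
    proof (rule dderiv_zero[OF ample_half_space that(1)])
      \<comment> \<open>By the triangle inequality the open ball of this radius around
        \<open>q\<close> stays outside the ball of radius \<open>R\<close>, where \<open>u\<close>
        vanishes.\<close>
      show "0 < norm q - R" using that by simp
      show "u q' = 0" if "q' \<in> half_space" "dist q' q < norm q - R" for q'
        using that norm_triangle_ineq2[of q q'] by (intro R) (auto simp: dist_norm norm_minus_commute)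
    qed
    have "hderiv B (hderiv C u) p = 0" for B C
    proof (rule dderiv_zero[OF ample_half_space p(1)])
      show "0 < norm p - R" using p by simp
      show "hderiv C u q = 0" if "q \<in> half_space" "dist q p < norm p - R" for q
        using that norm_triangle_ineq2[of p q] by (intro 1) (auto simp: dist_norm norm_minus_commute)
    qed
    then show ?thesis
      by (simp add: hessian_norm_sq_def)
  qed
  have "compact (half_space \<inter> cball 0 (R + 1) :: ((real^'a) \<times> real) set)"
    using ample_half_space unfolding ample_def by (intro closed_Int_compact) auto
  then have "integrable lborel (\<lambda>p. indicator (half_space \<inter> cball 0 (R + 1)) p *\<^sub>R ?H p)"
    by (rule borel_integrable_compact) (rule continuous_on_subset[OF c], auto)
  moreover have "indicator (half_space \<inter> cball 0 (R + 1)) p *\<^sub>R ?H p = indicator half_space p *\<^sub>R ?H p" for p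
    using z[of p] by (auto simp: indicator_def not_le)
  ultimately show ?thesis
    by (simp only: set_integrable_def)
qed

text \<open>Parseval works at fixed \<open>y\<close>, the completed square at fixed
  \<open>\<xi>\<close>; Tonelli links the two. The measurability statement is exported because a
  null iterated integral is later converted into a statement for almost every
  \<open>\<xi>\<close>.\<close>

lemma hessian_energy:
  fixes u :: "(real^'n) \<times> real \<Rightarrow> real"
  assumes u: "u \<in> test_functions half_space"
  shows "ennreal (LINT p:half_space|lborel. hessian_norm_sq half_space u p) =
    ennreal (1 / (2 * pi) ^ DIM(real^'n)) *
      ((\<integral>\<^sup>+\<xi>. \<integral>\<^sup>+y. ennreal (indicator {0..} y * deficit (norm \<xi>) (ftx u \<xi> y) (ftx (hderiv (0, 1) u) \<xi> y)
          (ftx (hderiv (0, 1) (hderiv (0, 1) u)) \<xi> y)) \<partial>lborel \<partial>lborel) +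
       (\<integral>\<^sup>+\<xi>. ennreal (boundary_form (norm \<xi>) (ftx u \<xi> 0) (ftx (hderiv (0, 1) u) \<xi> 0)) \<partial>lborel))"
    (is "_ = ennreal ?K * ((\<integral>\<^sup>+\<xi>. \<integral>\<^sup>+y. ?Q \<xi> y \<partial>lborel \<partial>lborel) + (\<integral>\<^sup>+\<xi>. ennreal (?B \<xi>) \<partial>lborel))")
    and "(\<lambda>(\<xi>, y). ennreal (indicator {0..} y * deficit (norm \<xi>) (ftx u \<xi> y) (ftx (hderiv (0, 1) u) \<xi> y)
          (ftx (hderiv (0, 1) (hderiv (0, 1) u)) \<xi> y))) \<in> borel_measurable (lborel \<Otimes>\<^sub>M lborel)"
proof -
  let ?H = "hessian_norm_sq half_space u"
  let ?u1 = "hderiv (0, 1) u" and ?u2 = "hderiv (0, 1) (hderiv (0, 1) u)"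
  let ?E = "\<lambda>\<xi> y. energy (norm \<xi>) (ftx u \<xi> y) (ftx ?u1 \<xi> y) (ftx ?u2 \<xi> y)"
  let ?i = "indicator {0..} :: real \<Rightarrow> real"
  note t = hderiv_y_test[OF u] hderiv_y_test[OF hderiv_y_test[OF u]]
  note [measurable] = ftx_measurable[OF u] ftx_measurable[OF t(1)] ftx_measurable[OF t(2)]
  have Hn: "0 \<le> ?H p" for p
    unfolding hessian_norm_sq_def by (intro sum_nonneg) simp
  \<comment> \<open>\<open>deficit\<close> vanishes when its three complex arguments are 0, so the
    indicator may be moved onto each of them; the truncated transforms are the jointly measurable
    ones.\<close>
  have "(\<lambda>(\<xi>, y). ennreal (?i y * deficit (norm \<xi>) (ftx u \<xi> y) (ftx ?u1 \<xi> y) (ftx ?u2 \<xi> y))) =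
      (\<lambda>p. ennreal (deficit (norm (fst p)) (?i (snd p) *\<^sub>R ftx u (fst p) (snd p))
        (?i (snd p) *\<^sub>R ftx ?u1 (fst p) (snd p)) (?i (snd p) *\<^sub>R ftx ?u2 (fst p) (snd p))))"
    by (auto simp: fun_eq_iff indicator_def deficit_def)
  also have "\<dots> \<in> borel_measurable (lborel \<Otimes>\<^sub>M lborel)"
    unfolding deficit_def by measurable
  finally show Qm [measurable]: "(\<lambda>(\<xi>, y). ?Q \<xi> y) \<in> borel_measurable (lborel \<Otimes>\<^sub>M lborel)" .
  have "(\<lambda>(\<xi>, y). ennreal (?i y * ?E \<xi> y)) =
      (\<lambda>p. ennreal (energy (norm (fst p)) (?i (snd p) *\<^sub>R ftx u (fst p) (snd p))
        (?i (snd p) *\<^sub>R ftx ?u1 (fst p) (snd p)) (?i (snd p) *\<^sub>R ftx ?u2 (fst p) (snd p))))"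
    by (auto simp: fun_eq_iff indicator_def energy_def)
  also have "\<dots> \<in> borel_measurable (lborel \<Otimes>\<^sub>M lborel)"
    unfolding energy_def by measurable
  finally have Em [measurable]: "(\<lambda>(\<xi>, y). ennreal (?i y * ?E \<xi> y)) \<in> borel_measurable (lborel \<Otimes>\<^sub>M lborel)" .
  have ft0: "(\<lambda>\<xi>. ftx g \<xi> 0) \<in> borel_measurable borel" if "g \<in> test_functions half_space"
    for g :: "(real^'n) \<times> real \<Rightarrow> real"
  proof -
    note [measurable] = test_function_measurable[OF slice_test_function[OF that order_refl]]
    show ?thesis
      unfolding ftx_def by measurable
  qed
  note [measurable] = ft0[OF u] ft0[OF t(1)]
  have Bm [measurable]: "(\<lambda>\<xi>. ennreal (?B \<xi>)) \<in> borel_measurable lborel"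
    unfolding boundary_form_def by measurable
  note Hi = hessian_integrable[OF u, unfolded set_integrable_def]
  have Hm [measurable]: "(\<lambda>p. ennreal (indicator half_space p *\<^sub>R ?H p)) \<in> borel_measurable (lborel \<Otimes>\<^sub>M lborel)"
    using borel_measurable_integrable[OF Hi] unfolding lborel_prod by measurable
  have slice: "(\<integral>\<^sup>+x. ennreal (indicator half_space (x, y) *\<^sub>R ?H (x, y)) \<partial>lborel) =
      (\<integral>\<^sup>+\<xi>. ennreal ?K * ennreal (?i y * ?E \<xi> y) \<partial>lborel)" for y
  proof (cases "0 \<le> y")
    case True
    note S = hessian_slice[OF u True]
    have "(\<integral>\<^sup>+x. ennreal (indicator half_space (x, y) *\<^sub>R ?H (x, y)) \<partial>lborel) = (\<integral>\<^sup>+x. ennreal (?H (x, y)) \<partial>lborel)"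
      using True by (simp add: half_space_def)
    also have "\<dots> = ennreal ((LINT \<xi>|lborel. ?E \<xi> y) / (2 * pi) ^ DIM(real^'n))"
      by (subst nn_integral_eq_integral[OF S(1)]) (simp_all only: S(3) Hn AE_I2)
    also have "\<dots> = ennreal (LINT \<xi>|lborel. ?K * ?E \<xi> y)"
      by simp
    also have "\<dots> = (\<integral>\<^sup>+\<xi>. ennreal (?K * ?E \<xi> y) \<partial>lborel)"
      by (intro nn_integral_eq_integral[symmetric] integrable_mult_right S(2) AE_I2 mult_nonneg_nonneg energy_nonneg) simp
    also have "\<dots> = (\<integral>\<^sup>+\<xi>. ennreal ?K * ennreal (?i y * ?E \<xi> y) \<partial>lborel)"
      using True by (intro nn_integral_cong) (simp add: ennreal_mult'[symmetric] energy_nonneg)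
    finally show ?thesis .
  qed (simp add: half_space_def)
  have per: "(\<integral>\<^sup>+y. ennreal (?i y * ?E \<xi> y) \<partial>lborel) = (\<integral>\<^sup>+y. ?Q \<xi> y \<partial>lborel) + ennreal (?B \<xi>)" for \<xi>
  proof -
    obtain R where R: "0 \<le> R" "\<forall>y\<ge>R. ftx u \<xi> y = 0 \<and> ftx ?u1 \<xi> y = 0 \<and> ftx ?u2 \<xi> y = 0"
      using common_support[OF u t] by blast
    show ?thesis
      by (rule energy_identity[OF ftx_dderiv_y[OF u] ftx_dderiv_y[OF t(1)] ftx_continuous[OF t(2)], where R=R])
        (use R in auto)
  qed
  have "ennreal (LINT p:half_space|lborel. ?H p) = (\<integral>\<^sup>+p. ennreal (indicator half_space p *\<^sub>R ?H p) \<partial>lborel)"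
    unfolding set_lebesgue_integral_def using Hn
    by (intro nn_integral_eq_integral[symmetric] Hi) (simp add: indicator_def)
  also have "\<dots> = (\<integral>\<^sup>+y. \<integral>\<^sup>+x. ennreal (indicator half_space (x, y) *\<^sub>R ?H (x, y)) \<partial>lborel \<partial>lborel)"
    unfolding lborel_prod[symmetric] by (rule lborel_pair.nn_integral_snd[symmetric]) measurable
  also have "\<dots> = (\<integral>\<^sup>+y. \<integral>\<^sup>+\<xi>. ennreal ?K * ennreal (?i y * ?E \<xi> y) \<partial>lborel \<partial>lborel)"
    by (simp only: slice)
  \<comment> \<open>Tonelli makes \<open>y\<close> the inner variable, as the identity at fixed
    \<open>\<xi>\<close> requires.\<close>
  also have "\<dots> = (\<integral>\<^sup>+\<xi>. \<integral>\<^sup>+y. ennreal ?K * ennreal (?i y * ?E \<xi> y) \<partial>lborel \<partial>lborel)"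
    by (rule lborel_pair.Fubini') measurable
  also have "\<dots> = (\<integral>\<^sup>+\<xi>. ennreal ?K * ((\<integral>\<^sup>+y. ?Q \<xi> y \<partial>lborel) + ennreal (?B \<xi>)) \<partial>lborel)"
    unfolding per[symmetric] by (intro nn_integral_cong nn_integral_cmult) measurable
  also have "\<dots> = ennreal ?K * ((\<integral>\<^sup>+\<xi>. \<integral>\<^sup>+y. ?Q \<xi> y \<partial>lborel \<partial>lborel) + (\<integral>\<^sup>+\<xi>. ennreal (?B \<xi>) \<partial>lborel))"
    by (subst nn_integral_cmult, measurable, subst nn_integral_add) measurable
  finally show "ennreal (LINT p:half_space|lborel. ?H p) =
    ennreal ?K * ((\<integral>\<^sup>+\<xi>. \<integral>\<^sup>+y. ?Q \<xi> y \<partial>lborel \<partial>lborel) + (\<integral>\<^sup>+\<xi>. ennreal (?B \<xi>) \<partial>lborel))" .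
qed

text \<open>A null integral gives a null inner integral for almost every \<open>\<xi>\<close> only,
  but for each such \<open>\<xi>\<close> continuity in \<open>y\<close> yields the second-order
  equation at every \<open>y \<ge> 0\<close>. Inversion on slices tolerates the exceptional null
  set.\<close>

lemma deficit_zero_iff:
  fixes u :: "(real^'n) \<times> real \<Rightarrow> real"
  assumes u: "u \<in> test_functions half_space"
  shows "(\<integral>\<^sup>+\<xi>. \<integral>\<^sup>+y. ennreal (indicator {0..} y * deficit (norm \<xi>) (ftx u \<xi> y) (ftx (hderiv (0, 1) u) \<xi> y)
          (ftx (hderiv (0, 1) (hderiv (0, 1) u)) \<xi> y)) \<partial>lborel \<partial>lborel) = 0 \<longleftrightarrow> (\<forall>p\<in>half_space. u p = 0)"
    (is "(\<integral>\<^sup>+\<xi>. \<integral>\<^sup>+y. ?Q \<xi> y \<partial>lborel \<partial>lborel) = 0 \<longleftrightarrow> _")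
proof
  let ?u1 = "hderiv (0, 1) u" and ?u2 = "hderiv (0, 1) (hderiv (0, 1) u)"
  let ?D = "\<lambda>\<xi> y. deficit (norm \<xi>) (ftx u \<xi> y) (ftx ?u1 \<xi> y) (ftx ?u2 \<xi> y)"
  note t = hderiv_y_test[OF u] hderiv_y_test[OF hderiv_y_test[OF u]]
  assume z: "(\<integral>\<^sup>+\<xi>. \<integral>\<^sup>+y. ?Q \<xi> y \<partial>lborel \<partial>lborel) = 0"
  have "(\<lambda>\<xi>. \<integral>\<^sup>+y. ?Q \<xi> y \<partial>lborel) \<in> borel_measurable lborel"
    using hessian_energy(2)[OF u] by measurable
  then have "AE \<xi> in lborel. (\<integral>\<^sup>+y. ?Q \<xi> y \<partial>lborel) = 0"
    using z by (simp add: nn_integral_0_iff_AE)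
  moreover have "\<forall>y\<ge>0. ftx u \<xi> y = 0" if q0: "(\<integral>\<^sup>+y. ?Q \<xi> y \<partial>lborel) = 0" for \<xi>
  proof -
    obtain R where R: "0 \<le> R" "\<forall>y\<ge>R. ftx u \<xi> y = 0 \<and> ftx ?u1 \<xi> y = 0 \<and> ftx ?u2 \<xi> y = 0"
      using common_support[OF u t] by blast
    have "continuous_on {0..} (?D \<xi>)"
      unfolding deficit_def by (intro continuous_intros ftx_continuous u t)
    then have D0: "?D \<xi> y = 0" if "0 \<le> y" for y
      using R(2) q0 that by (rule_tac half_line_zero[where R=R]) (auto simp: deficit_def)
    show ?thesis
    proof (intro allI impI)
      fix y :: real assume "0 \<le> y"
      then show "ftx u \<xi> y = 0"
        by (rule second_order_decay[OF ftx_dderiv_y[OF u] ftx_dderiv_y[OF t(1)], where r="norm \<xi>" and R=R, rotated -1])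
          (use D0 R in \<open>auto simp: deficit_def\<close>)
    qed
  qed
  ultimately have "AE \<xi> in lborel. \<forall>y\<ge>0. ftx u \<xi> y = 0"
    by (auto elim: eventually_mono)
  then show "\<forall>p\<in>half_space. u p = 0"
    using ftx_zero_imp_zero[OF u] by blast
next
  assume z: "\<forall>p\<in>half_space. u p = 0"
  then have z1: "hderiv b u p = 0" if "p \<in> half_space" for b p
    using that by (intro hderiv_zero) auto
  have z2: "hderiv b (hderiv c u) p = 0" if "p \<in> half_space" for b c p
    by (rule hderiv_zero[OF z1 that])
  have "?Q \<xi> y = 0" for \<xi> y
    using z z1 z2 by (cases "0 \<le> y") (auto simp: deficit_def ftx_def fourier_def half_space_def)
  then show "(\<integral>\<^sup>+\<xi>. \<integral>\<^sup>+y. ?Q \<xi> y \<partial>lborel \<partial>lborel) = 0"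
    by simp
qed

theorem corollary5p2:
  fixes u :: "(real^'n) \<times> real \<Rightarrow> real"
    and f \<psi> :: "real^'n \<Rightarrow> real"
  assumes n: "2 \<le> CARD('n)"
    and u: "u \<in> test_functions half_space"
    and f: "\<And>x. f x = u (x, 0)"
    and \<psi>: "\<And>x. \<psi> x = - dderiv half_space (0, 1) u (x, 0)"
  shows "(LINT p:half_space|lborel. hessian_norm_sq half_space u p)
           \<ge> 2 * (LINT x|lborel. f x * frac_laplacian (3/2) f x
                     - grad f x \<bullet> grad \<psi> x + \<psi> x * frac_laplacian (1/2) \<psi> x)
       \<and> ((LINT p:half_space|lborel. hessian_norm_sq half_space u p)
            = 2 * (LINT x|lborel. f x * frac_laplacian (3/2) f x
                     - grad f x \<bullet> grad \<psi> x + \<psi> x * frac_laplacian (1/2) \<psi> x)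
          \<longleftrightarrow> (\<forall>p\<in>half_space. bilaplacian half_space u p = 0))"
proof -
  let ?u1 = "hderiv (0, 1) u"
  let ?L = "LINT p:half_space|lborel. hessian_norm_sq half_space u p"
  let ?R = "2 * (LINT x|lborel. f x * frac_laplacian (3/2) f x
      - grad f x \<bullet> grad \<psi> x + \<psi> x * frac_laplacian (1/2) \<psi> x)"
  let ?K = "1 / (2 * pi) ^ DIM(real^'n)"
  let ?B = "\<lambda>\<xi>. boundary_form (norm \<xi>) (ftx u \<xi> 0) (ftx ?u1 \<xi> 0)"
  define X where "X = (\<integral>\<^sup>+\<xi>. \<integral>\<^sup>+y. ennreal (indicator {0..} y * deficit (norm \<xi>) (ftx u \<xi> y)
      (ftx ?u1 \<xi> y) (ftx (hderiv (0, 1) ?u1) \<xi> y)) \<partial>lborel \<partial>lborel)"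
  have f_eq: "f = (\<lambda>x. u (x, 0))"
    using f by auto
  \<comment> \<open>The zero summand gives the sign change the binary shape of the linear
    combination lemmas.\<close>
  have \<psi>_eq: "\<psi> = (\<lambda>x. (- 1) * ?u1 (x, 0) + 0 * ?u1 (x, 0))"
    using \<psi> by auto
  have tf: "f \<in> test_functions UNIV"
    unfolding f_eq using u by (rule slice_test_function) simp
  have t1: "(\<lambda>x. ?u1 (x, 0)) \<in> test_functions UNIV"
    using hderiv_y_test[OF u] by (rule slice_test_function) simp
  have t\<psi>: "\<psi> \<in> test_functions UNIV"
    unfolding \<psi>_eq by (intro test_functions_lincomb t1)
  have B_eq: "boundary_form (norm \<xi>) (ft f \<xi>) (- ft \<psi> \<xi>) = ?B \<xi>" for \<xi>
    unfolding \<psi>_eq ft_lincomb[OF t1 t1] by (simp add: f_eq ftx_def)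
  note BI = boundary_integral[OF tf t\<psi>, unfolded B_eq]
  have R_eq: "?R = ?K * (LINT \<xi>|lborel. ?B \<xi>)"
    using BI(2) by simp
  have B0: "0 \<le> (LINT \<xi>|lborel. ?B \<xi>)"
    by (intro integral_nonneg_AE AE_I2 boundary_form_nonneg norm_ge_zero)
  have K0: "0 \<le> ?K"
    by simp
  \<comment> \<open>\<open>ennreal\<close> sends negative numbers to 0, so the signs of both sides
    are recorded for the return to real numbers.\<close>
  have R0: "0 \<le> ?R"
    unfolding R_eq using B0 by (intro mult_nonneg_nonneg) auto
  have L0: "0 \<le> ?L"
    unfolding set_lebesgue_integral_def hessian_norm_sq_def
    by (intro integral_nonneg_AE AE_I2 scaleR_nonneg_nonneg indicator_pos_le sum_nonneg) simp
  have "ennreal ?L = ennreal ?K * (X + (\<integral>\<^sup>+\<xi>. ennreal (?B \<xi>) \<partial>lborel))"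
    unfolding X_def by (rule hessian_energy(1)[OF u])
  also have "(\<integral>\<^sup>+\<xi>. ennreal (?B \<xi>) \<partial>lborel) = ennreal (LINT \<xi>|lborel. ?B \<xi>)"
    by (intro nn_integral_eq_integral BI(1) AE_I2 boundary_form_nonneg norm_ge_zero)
  also have "ennreal ?K * (X + ennreal (LINT \<xi>|lborel. ?B \<xi>)) = ennreal ?K * X + ennreal ?R"
    unfolding R_eq ennreal_mult[OF K0 B0] by (rule distrib_left)
  finally have eq: "ennreal ?L = ennreal ?K * X + ennreal ?R" .
  have "ennreal ?R \<le> ennreal ?L"
    unfolding eq by simp
  then have "?R \<le> ?L"
    using L0 by (simp only: ennreal_le_iff)
  moreover have "?L = ?R \<longleftrightarrow> ennreal ?K * X = 0"
  proof
    assume LR: "?L = ?R"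
    \<comment> \<open>Cancelling \<open>ennreal ?R\<close> is legitimate because it is finite; no
      prior finiteness of \<open>X\<close> enters.\<close>
    have "ennreal ?R + ennreal ?K * X = ennreal ?R + 0"
      unfolding add_0_right add.commute[of "ennreal ?R"] eq[symmetric] by (simp only: LR)
    then show "ennreal ?K * X = 0"
      unfolding ennreal_add_left_cancel by simp
  next
    assume "ennreal ?K * X = 0"
    then have "ennreal ?L = ennreal ?R"
      using eq by simp
    then show "?L = ?R"
      using L0 R0 by (simp only: ennreal_inj)
  qed
  moreover have "ennreal ?K * X = 0 \<longleftrightarrow> X = 0"
  proof -
    have "0 < ?K"
      by simp
    then have "ennreal ?K \<noteq> 0"
      by (simp only: ennreal_eq_0_iff not_le)
    then show ?thesis
      by (simp only: mult_eq_0_iff simp_thms)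
  qed
  moreover have "X = 0 \<longleftrightarrow> (\<forall>p\<in>half_space. bilaplacian half_space u p = 0)"
    unfolding X_def deficit_zero_iff[OF u] bilaplacian_zero_iff[OF u] ..
  ultimately show ?thesis
    by blast
qed

end
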